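(* Let $H$ be the free group on $\{a_2,b_2\}$ and $G=\langle\alpha,\beta\mid\beta\alpha=\alpha^{-1}\beta\rangle$, with action $\varphi\colon G\to\mathrm{Aut}(H)$ given by $\varphi(\alpha)(a_2)=a_2$, $\varphi(\alpha)(b_2)=a_2^{-2}b_2$, $\varphi(\beta)(a_2)=a_2^{-1}$, $\varphi(\beta)(b_2)=a_2b_2a_2$, so that $P_2(\mathbb{K})\cong H\rtimes_\varphi G$ (with $\alpha=a_1a_2$, $\beta=b_2b_1$). Then for all $n\geq2$, $$\Gamma_n(P_2(\mathbb{K}))=N_n\rtimes_\varphi\langle\alpha^{2^{n-1}}\rangle,$$ where $N_n$ is the normal closure in $H$ of $\{a_2^{2^{n-1}}\}\cup\{x^{2^{n-i}} : x\in\Gamma_i(H),\ 2\leq i\leq n\}$. Consequently $P_2(\mathbb{K})$ is residually nilpotent.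
   Context: $\mathbb{K}$ is the Klein bottle, $P_2(\mathbb{K})$ its 2-string pure braid group; $H$ corresponds to $\pi_1(\mathbb{K}\setminus\{x_1\})$, the kernel of forgetting the second string. $\Gamma_1(G)=G$, $\Gamma_{i+1}(G)=[\Gamma_i(G),G]$; a group is residually nilpotent iff $\bigcap_i\Gamma_i=\{1\}$. *)

theory Defs
  imports "HOL-Algebra.Algebra"
begin

definition commutator :: "('a, 'b) monoid_scheme \<Rightarrow> 'a \<Rightarrow> 'a \<Rightarrow> 'a" where
  "commutator G x y = inv\<^bsub>G\<^esub> x \<otimes>\<^bsub>G\<^esub> inv\<^bsub>G\<^esub> y \<otimes>\<^bsub>G\<^esub> x \<otimes>\<^bsub>G\<^esub> y"

text \<open>Gamma G n is the n-th term of the lower central series, indexed from 1: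
  Gamma_1 = G, Gamma_(i+1) = [Gamma_i, G]. (Gamma G 0 is set to G as a harmless convention.)\<close>
fun Gamma :: "('a, 'b) monoid_scheme \<Rightarrow> nat \<Rightarrow> 'a set" where
  "Gamma G 0 = carrier G"
| "Gamma G (Suc 0) = carrier G"
| "Gamma G (Suc (Suc i)) =
     generate G {commutator G x y | x y. x \<in> Gamma G (Suc i) \<and> y \<in> carrier G}"

definition normal_closure :: "('a, 'b) monoid_scheme \<Rightarrow> 'a set \<Rightarrow> 'a set" where
  "normal_closure G S = generate G {g \<otimes>\<^bsub>G\<^esub> s \<otimes>\<^bsub>G\<^esub> inv\<^bsub>G\<^esub> g | g s. g \<in> carrier G \<and> s \<in> S}"

definition residually_nilpotent :: "('a, 'b) monoid_scheme \<Rightarrow> bool" where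
  "residually_nilpotent G \<longleftrightarrow> (\<Inter>i\<in>{1..}. Gamma G i) = {\<one>\<^bsub>G\<^esub>}"

datatype gen = A2 | B2

type_synonym letter = "gen \<times> bool"  \<comment> \<open>(generator, True = inverse letter)\<close>
type_synonym word = "letter list"

definition inv_letter :: "letter \<Rightarrow> letter" where
  "inv_letter l = (fst l, \<not> snd l)"

fun cons_red :: "letter \<Rightarrow> word \<Rightarrow> word" where
  "cons_red l [] = [l]"
| "cons_red l (y # ys) = (if y = inv_letter l then ys else l # y # ys)"

definition reduce :: "word \<Rightarrow> word" where
  "reduce w = foldr cons_red w []"

fun reduced :: "word \<Rightarrow> bool" where
  "reduced [] = True"
| "reduced [x] = True"
| "reduced (x # y # ys) = (y \<noteq> inv_letter x \<and> reduced (y # ys))"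

definition inv_word :: "word \<Rightarrow> word" where
  "inv_word w = rev (map inv_letter w)"

definition H :: "word monoid" where
  "H = \<lparr>carrier = {w. reduced w}, monoid.mult = (\<lambda>x y. reduce (x @ y)), one = []\<rparr>"

definition a2 :: word where "a2 = [(A2, False)]"
definition b2 :: word where "b2 = [(B2, False)]"

definition subst :: "(gen \<Rightarrow> word) \<Rightarrow> word \<Rightarrow> word" where
  "subst f w = reduce (concat (map (\<lambda>(x, i). if i then inv_word (f x) else f x) w))"

definition phi_alpha :: "word \<Rightarrow> word" where
  "phi_alpha = subst (\<lambda>x. case x of A2 \<Rightarrow> a2
                                   | B2 \<Rightarrow> inv\<^bsub>H\<^esub> a2 \<otimes>\<^bsub>H\<^esub> inv\<^bsub>H\<^esub> a2 \<otimes>\<^bsub>H\<^esub> b2)"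

definition phi_beta :: "word \<Rightarrow> word" where
  "phi_beta = subst (\<lambda>x. case x of A2 \<Rightarrow> inv\<^bsub>H\<^esub> a2
                                  | B2 \<Rightarrow> a2 \<otimes>\<^bsub>H\<^esub> b2 \<otimes>\<^bsub>H\<^esub> a2)"

definition zpow_fun :: "(word \<Rightarrow> word) \<Rightarrow> int \<Rightarrow> word \<Rightarrow> word" where
  "zpow_fun f m = (if 0 \<le> m then f ^^ nat m else (inv_into (carrier H) f) ^^ nat (- m))"

text \<open>Every element of G has a unique normal form alpha^m beta^k (m, k integers);
  we represent it by the pair (m, k). Using beta^k alpha = alpha^((-1)^k) beta^k:\<close>
definition G_mult :: "int \<times> int \<Rightarrow> int \<times> int \<Rightarrow> int \<times> int" where
  "G_mult g h = (fst g + (if even (snd g) then fst h else - fst h), snd g + snd h)"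

definition G :: "(int \<times> int) monoid" where
  "G = \<lparr>carrier = UNIV, monoid.mult = G_mult, one = (0, 0)\<rparr>"

definition alpha :: "int \<times> int" where "alpha = (1, 0)"
definition beta :: "int \<times> int" where "beta = (0, 1)"

definition phi :: "int \<times> int \<Rightarrow> word \<Rightarrow> word" where
  "phi g = zpow_fun phi_alpha (fst g) \<circ> zpow_fun phi_beta (snd g)"

definition P2K :: "(word \<times> (int \<times> int)) monoid" where
  "P2K = \<lparr>carrier = carrier H \<times> carrier G,
          monoid.mult = (\<lambda>(h1, g1) (h2, g2). (h1 \<otimes>\<^bsub>H\<^esub> phi g1 h2, g1 \<otimes>\<^bsub>G\<^esub> g2)),
          one = (\<one>\<^bsub>H\<^esub>, \<one>\<^bsub>G\<^esub>)\<rparr>"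

definition N :: "nat \<Rightarrow> word set" where
  "N n = normal_closure H
     ({a2 [^]\<^bsub>H\<^esub> (2::nat) ^ (n - 1)} \<union>
      {x [^]\<^bsub>H\<^esub> (2::nat) ^ (n - i) | x i. 2 \<le> i \<and> i \<le> n \<and> x \<in> Gamma H i})"

end

theory Submission
  imports Defs
begin

text \<open>
  Let \<open>P\<close> be the semidirect product, \<open>U\<close> its free normal subgroup, \<open>F\<^sub>i\<close> the lower central series of
  \<open>U\<close> and \<open>M\<^sub>n\<close> the normal closure in \<open>P\<close> of the powers in the statement, including
  \<open>\<alpha>\<close> to the power \<open>2^(n-1)\<close>.
  From the second one on, the quotients \<open>\<Gamma>\<^sub>n(P) / \<Gamma>\<^sub>n\<^sub>+\<^sub>1(P)\<close> have exponent two, so \<open>M\<^sub>n \<subseteq> \<Gamma>\<^sub>n(P)\<close>.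
  As \<open>P\<close> acts trivially on \<open>F\<^sub>i\<close> modulo squares and \<open>F\<^sub>i\<^sub>+\<^sub>1\<close>, an induction gives
  \<open>\<Gamma>\<^sub>n(P) \<subseteq> M\<^sub>n \<Gamma>\<^sub>n\<^sub>+\<^sub>1(P)\<close>. This replaces the collection process: commuting a power past a
  generator is only ever computed modulo the next term of the series. Since \<open>F\<^sub>j\<close> has finite
  exponent modulo \<open>M\<^sub>n F\<^sub>j\<^sub>+\<^sub>1\<close> for \<open>2 \<le> j < n\<close>, some \<open>\<Gamma>\<^sub>m(P)\<close> lies in \<open>M\<^sub>n\<close>, and the inclusion
  \<open>\<Gamma>\<^sub>n(P) \<subseteq> M\<^sub>n\<close> follows by descending induction.
  For residual nilpotence, the free group embeds into \<open>SL\<^sub>2(\<int>)\<close> by Sanov's theorem, and \<open>N\<^sub>n\<close> lands in the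
  principal congruence subgroup of level \<open>2^n\<close>.
\<close>

subsection \<open>Commutators modulo a normal subgroup\<close>

text \<open>The powers of 2 come from \<open>t\<close>: it inverts \<open>a\<close> and
  \<open>s\<close>, so [a,t] = a^-2. Squares then propagate, because [u^2,p] agrees with [u,p]^2 as
  soon as [u,p] commutes with u. For higher powers [x^(2^k),p] differs from [x,p]^(2^k) by iterated
  commutators; controlling these inside M_n itself would take a collection formula. Working modulo
  \<Gamma>_(n+1) removes them, but yields only an approximation of \<Gamma>_n, and iterating it
  needs an end point, hence the search for some \<Gamma>_m inside M_n. No power of \<open>b\<close>
  is among the chosen powers, so the exponent argument has to start at F_2 and not at U. The level
  2^n has a similar origin: a2 counts with weight 1 and F_i with weight i. An element of weight i is
  mapped into level 2^i, and each squaring doubles the level. Congruences modulo M are treated as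
  equations in \<open>G Mod M\<close>. Its multiplication is kept opaque, hence the two removed simp
  rules, so that identities proved for arbitrary groups apply to cosets.\<close>

declare mult_FactGroup [simp del] one_FactGroup [simp del]

context group
begin

lemma mult_inv_cancel_left:
  assumes "x \<in> carrier G" "y \<in> carrier G"
  shows "x \<otimes> (inv x \<otimes> y) = y" "inv x \<otimes> (x \<otimes> y) = y"
  using assms by (simp_all add: m_assoc[symmetric])

lemmas word_simps = m_assoc inv_mult_group mult_inv_cancel_left

lemma commutator_closed [simp]:
  "x \<in> carrier G \<Longrightarrow> y \<in> carrier G \<Longrightarrow> commutator G x y \<in> carrier G"
  by (simp add: commutator_def)

lemma commutator_eq_one_iff:
  assumes "x \<in> carrier G" "y \<in> carrier G"
  shows "commutator G x y = \<one> \<longleftrightarrow> x \<otimes> y = y \<otimes> x"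
proof -
  have "y \<otimes> x \<otimes> commutator G x y = x \<otimes> y"
    using assms by (simp add: commutator_def word_simps)
  then show ?thesis
    using assms r_cancel_one[of "y \<otimes> x" "commutator G x y"] by auto
qed

lemma commutator_inv:
  "x \<in> carrier G \<Longrightarrow> y \<in> carrier G \<Longrightarrow> inv (commutator G x y) = commutator G y x"
  by (simp add: commutator_def word_simps)

text \<open>In any group [u^2,p] is u^-1 [u,p] u [u,p]; commuting removes the conjugation. Applied
  in a quotient, this identity transports squares along the series.\<close>

lemma commutator_square:
  assumes "u \<in> carrier G" "p \<in> carrier G"
    and "commutator G u p \<otimes> u = u \<otimes> commutator G u p"
  shows "commutator G (u \<otimes> u) p = commutator G u p \<otimes> commutator G u p"
proof -
  have "commutator G (u \<otimes> u) p = inv u \<otimes> (commutator G u p \<otimes> u) \<otimes> commutator G u p"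
    using assms(1,2) by (simp add: commutator_def word_simps)
  also have "\<dots> = commutator G u p \<otimes> commutator G u p"
    unfolding assms(3) using assms(1,2) by (simp add: word_simps)
  finally show ?thesis .
qed

lemma quotient_hom:
  assumes "M \<lhd> G" shows "group_hom G (G Mod M) (\<lambda>x. M #> x)"
  unfolding group_hom_def group_hom_axioms_def
  using assms normal.factorgroup_is_group normal.r_coset_hom_Mod group_axioms by blast

lemma quotient_one_iff:
  assumes "M \<lhd> G" "x \<in> carrier G" shows "M #> x = \<one>\<^bsub>G Mod M\<^esub> \<longleftrightarrow> x \<in> M"
  using assms by (metis coset_join1 coset_join2 normal_imp_subgroup one_FactGroup subgroup.subset)

end

lemma (in group_hom) hom_commutator:
  assumes "x \<in> carrier G" "y \<in> carrier G"
  shows "h (commutator G x y) = commutator H (h x) (h y)"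
  using assms by (simp add: commutator_def)

context group
begin

text \<open>The bridge between the two languages: membership of a commutator in M becomes an
  equation between cosets, to which identities valid in every group apply.\<close>

lemma commutator_in_normal_iff:
  assumes "M \<lhd> G" "x \<in> carrier G" "y \<in> carrier G"
  shows "commutator G x y \<in> M \<longleftrightarrow>
    (M #> x) \<otimes>\<^bsub>G Mod M\<^esub> (M #> y) = (M #> y) \<otimes>\<^bsub>G Mod M\<^esub> (M #> x)"
proof -
  interpret q: group_hom G "G Mod M" "\<lambda>x. M #> x" using assms(1) by (rule quotient_hom)
  show ?thesis
    using quotient_one_iff[OF assms(1), of "commutator G x y"] assms(2,3)
    by (simp add: q.hom_commutator q.H.commutator_eq_one_iff)
qed

lemma commutator_mod_self:
  assumes "M \<lhd> G" "x \<in> M" "y \<in> carrier G"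
  shows "commutator G x y \<in> M" "commutator G y x \<in> M"
proof -
  interpret q: group_hom G "G Mod M" "\<lambda>x. M #> x" using assms(1) by (rule quotient_hom)
  have x: "x \<in> carrier G" using assms normal_imp_subgroup subgroup.mem_carrier by metis
  then have "M #> x = \<one>\<^bsub>G Mod M\<^esub>" using assms quotient_one_iff by simp
  then show "commutator G x y \<in> M" "commutator G y x \<in> M"
    using x assms by (simp_all add: commutator_in_normal_iff)
qed

lemma commutator_swap_in:
  assumes "subgroup M G" "x \<in> carrier G" "y \<in> carrier G" "commutator G x y \<in> M"
  shows "commutator G y x \<in> M"
  using assms commutator_inv subgroup.m_inv_closed by metis

lemma commutator_square_mod:
  assumes "M \<lhd> G" "u \<in> carrier G" "p \<in> carrier G"
    and "commutator G (commutator G u p) u \<in> M"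
  shows "commutator G (u \<otimes> u) p \<in> M \<longleftrightarrow> commutator G u p \<otimes> commutator G u p \<in> M"
proof -
  interpret q: group_hom G "G Mod M" "\<lambda>x. M #> x" using assms(1) by (rule quotient_hom)
  have "M #> commutator G (u \<otimes> u) p = M #> (commutator G u p \<otimes> commutator G u p)"
    using assms q.H.commutator_square[of "M #> u" "M #> p"]
    by (simp add: commutator_in_normal_iff q.hom_commutator)
  then show ?thesis
    using assms by (metis commutator_closed m_closed quotient_one_iff)
qed

lemma subgroup_commuting:
  assumes "U \<subseteq> carrier G"
  shows "subgroup {y \<in> carrier G. \<forall>x\<in>U. x \<otimes> y = y \<otimes> x} G"
proof (rule subgroupI)
  fix a assume a: "a \<in> {y \<in> carrier G. \<forall>x\<in>U. x \<otimes> y = y \<otimes> x}"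
  have "x \<otimes> inv a = inv a \<otimes> x" if "x \<in> U" for x
  proof -
    have x: "x \<in> carrier G" using that assms by blast
    have "x \<otimes> inv a = inv a \<otimes> (a \<otimes> x) \<otimes> inv a" using a x by (simp add: word_simps)
    also have "a \<otimes> x = x \<otimes> a" using a that by simp
    finally show ?thesis using a x by (simp add: word_simps)
  qed
  then show "inv a \<in> {y \<in> carrier G. \<forall>x\<in>U. x \<otimes> y = y \<otimes> x}" using a by simp
next
  fix a b assume a: "a \<in> {y \<in> carrier G. \<forall>x\<in>U. x \<otimes> y = y \<otimes> x}"
    and b: "b \<in> {y \<in> carrier G. \<forall>x\<in>U. x \<otimes> y = y \<otimes> x}"
  then show "a \<otimes> b \<in> {y \<in> carrier G. \<forall>x\<in>U. x \<otimes> y = y \<otimes> x}"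
    using assms by (simp add: subset_iff) (metis m_assoc)
next
  have "\<one> \<in> {y \<in> carrier G. \<forall>x\<in>U. x \<otimes> y = y \<otimes> x}" using assms by auto
  then show "{y \<in> carrier G. \<forall>x\<in>U. x \<otimes> y = y \<otimes> x} \<noteq> {}" by blast
qed (use assms in auto)

lemma subgroup_vimage:
  assumes "group_hom G K f" "subgroup S K"
  shows "subgroup {x \<in> carrier G. f x \<in> S} G"
proof -
  interpret f: group_hom G K f by fact
  show ?thesis
  proof (rule subgroupI)
    have "\<one> \<in> {x \<in> carrier G. f x \<in> S}" using assms(2) subgroup.one_closed by simp
    then show "{x \<in> carrier G. f x \<in> S} \<noteq> {}" by blast
  qed (use assms(2) in \<open>auto intro: subgroup.m_inv_closed subgroup.m_closed\<close>)
qed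

text \<open>The set is the preimage of the centralizer of the image of U in the quotient by
  M.\<close>

lemma subgroup_commutator_in:
  assumes "M \<lhd> G" "U \<subseteq> carrier G"
  shows "subgroup {y \<in> carrier G. \<forall>x\<in>U. commutator G x y \<in> M} G"
proof -
  interpret q: group_hom G "G Mod M" "\<lambda>x. M #> x" using assms(1) by (rule quotient_hom)
  have "{y \<in> carrier G. \<forall>x\<in>U. commutator G x y \<in> M} =
      {y \<in> carrier G. M #> y \<in> {v \<in> carrier (G Mod M). \<forall>u\<in>(\<lambda>x. M #> x) ` U.
         u \<otimes>\<^bsub>G Mod M\<^esub> v = v \<otimes>\<^bsub>G Mod M\<^esub> u}}"
    using assms by (auto simp: commutator_in_normal_iff subset_iff
        intro: q.hom_closed)
  moreover have "subgroup {v \<in> carrier (G Mod M). \<forall>u\<in>(\<lambda>x. M #> x) ` U.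
         u \<otimes>\<^bsub>G Mod M\<^esub> v = v \<otimes>\<^bsub>G Mod M\<^esub> u} (G Mod M)"
    by (rule q.H.subgroup_commuting) (use assms q.hom_closed in blast)
  ultimately show ?thesis
    by (simp only: subgroup_vimage[OF q.group_hom_axioms])
qed

text \<open>Two rounds of the centralizer argument, one for each entry, replace an induction over
  words. In between, the entries are exchanged by inverting the commutator.\<close>

lemma commutator_generate:
  assumes M: "M \<lhd> G" and "U \<subseteq> carrier G" "V \<subseteq> carrier G"
    and uv: "\<And>u v. u \<in> U \<Longrightarrow> v \<in> V \<Longrightarrow> commutator G u v \<in> M"
    and "x \<in> generate G U" "y \<in> generate G V"
  shows "commutator G x y \<in> M"
proof -
  have sN: "subgroup M G" using M normal_imp_subgroup by blast
  have "generate G V \<subseteq> {y \<in> carrier G. \<forall>x\<in>U. commutator G x y \<in> M}"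
    by (rule generate_subgroup_incl[OF _ subgroup_commutator_in[OF M]]) (use assms in auto)
  then have y: "y \<in> carrier G" "\<And>u. u \<in> U \<Longrightarrow> commutator G u y \<in> M" using assms(6) by auto
  have "generate G U \<subseteq> {u \<in> carrier G. \<forall>v\<in>{y}. commutator G v u \<in> M}"
    by (rule generate_subgroup_incl[OF _ subgroup_commutator_in[OF M]])
       (use y assms(2) commutator_swap_in[OF sN] in auto)
  then show ?thesis using assms(5) y(1) commutator_swap_in[OF sN] by blast
qed

text \<open>The set is the preimage of the centre of the quotient. Placing a term of a series inside
  it is how the next term is later placed inside M.\<close>

lemma normal_commutator_in:
  assumes M: "M \<lhd> G"
  shows "{x \<in> carrier G. \<forall>p\<in>carrier G. commutator G x p \<in> M} \<lhd> G"
proof -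
  have sN: "subgroup M G" using M normal_imp_subgroup by blast
  have eq: "{x \<in> carrier G. \<forall>p\<in>carrier G. commutator G x p \<in> M} =
    {x \<in> carrier G. \<forall>p\<in>carrier G. commutator G p x \<in> M}"
    using commutator_swap_in[OF sN] by blast
  show ?thesis
  proof (rule normal_invI)
    show "subgroup {x \<in> carrier G. \<forall>p\<in>carrier G. commutator G x p \<in> M} G"
      unfolding eq by (rule subgroup_commutator_in[OF M]) simp
  next
    fix g x assume g: "g \<in> carrier G"
      and "x \<in> {x \<in> carrier G. \<forall>p\<in>carrier G. commutator G x p \<in> M}"
    then have x: "x \<in> carrier G" "\<And>p. p \<in> carrier G \<Longrightarrow> commutator G x p \<in> M" by auto
    have "commutator G (g \<otimes> x \<otimes> inv g) p \<in> M" if p: "p \<in> carrier G" for p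
    proof -
      have "commutator G (g \<otimes> x \<otimes> inv g) p = g \<otimes> commutator G x (inv g \<otimes> p \<otimes> g) \<otimes> inv g"
        using g x p by (simp add: commutator_def word_simps)
      then show ?thesis using g p x(2)[of "inv g \<otimes> p \<otimes> g"] normal.inv_op_closed2[OF M] by simp
    qed
    then show "g \<otimes> x \<otimes> inv g \<in> {x \<in> carrier G. \<forall>p\<in>carrier G. commutator G x p \<in> M}"
      using g x by simp
  qed
qed

lemma conj_nat_pow:
  assumes "g \<in> carrier G" "x \<in> carrier G"
  shows "(g \<otimes> x \<otimes> inv g) [^] (k::nat) = g \<otimes> x [^] k \<otimes> inv g"
  by (induction k) (use assms in \<open>simp_all add: word_simps\<close>)

text \<open>B is abelian modulo M, so the k-th power map is a homomorphism from B to the quotient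
  and the set is its kernel. With k = 2 this reduces claims about all squares to normal
  generators.\<close>

lemma normal_pow_in:
  assumes M: "M \<lhd> G" and B: "B \<lhd> G"
    and c: "\<And>x y. x \<in> B \<Longrightarrow> y \<in> B \<Longrightarrow> commutator G x y \<in> M"
  shows "{y \<in> B. y [^] (k::nat) \<in> M} \<lhd> G"
proof -
  interpret q: group_hom G "G Mod M" "\<lambda>x. M #> x" using M by (rule quotient_hom)
  have sN: "subgroup M G" and sB: "subgroup B G" using M B normal_imp_subgroup by blast+
  have car: "x \<in> carrier G" if "x \<in> B" for x using subgroup.mem_carrier[OF sB that] .
  have iff: "y [^] k \<in> M \<longleftrightarrow> (M #> y) [^]\<^bsub>G Mod M\<^esub> k = \<one>\<^bsub>G Mod M\<^esub>" if "y \<in> B" for y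
    using quotient_one_iff[OF M, of "y [^] k"] car[OF that] by (simp add: q.hom_nat_pow)
  show ?thesis
  proof (rule normal_invI)
    show "subgroup {y \<in> B. y [^] k \<in> M} G"
    proof (rule subgroupI)
      have "\<one> \<in> B" using subgroup.one_closed[OF sB] .
      moreover have "\<one> [^] k \<in> M" using subgroup.one_closed[OF sN] by simp
      ultimately show "{y \<in> B. y [^] k \<in> M} \<noteq> {}" by blast
    next
      fix x assume x: "x \<in> {y \<in> B. y [^] k \<in> M}"
      then have "inv (x [^] k) \<in> M" using subgroup.m_inv_closed[OF sN] by simp
      then show "inv x \<in> {y \<in> B. y [^] k \<in> M}"
        using x car subgroup.m_inv_closed[OF sB] by (simp add: nat_pow_inv)
    next
      fix x y assume x: "x \<in> {y \<in> B. y [^] k \<in> M}" and y: "y \<in> {y \<in> B. y [^] k \<in> M}"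
      then have xy: "x \<otimes> y \<in> B" using subgroup.m_closed[OF sB] by simp
      have "(M #> x) \<otimes>\<^bsub>G Mod M\<^esub> (M #> y) = (M #> y) \<otimes>\<^bsub>G Mod M\<^esub> (M #> x)"
        using x y c[of x y] car by (simp add: commutator_in_normal_iff[OF M])
      moreover have "(M #> x) [^]\<^bsub>G Mod M\<^esub> k = \<one>\<^bsub>G Mod M\<^esub>"
        "(M #> y) [^]\<^bsub>G Mod M\<^esub> k = \<one>\<^bsub>G Mod M\<^esub>" using x y iff by blast+
      ultimately have "(M #> (x \<otimes> y)) [^]\<^bsub>G Mod M\<^esub> k = \<one>\<^bsub>G Mod M\<^esub>"
        using x y car q.H.pow_mult_distrib[of "M #> x" "M #> y" k] by simp
      then show "x \<otimes> y \<in> {y \<in> B. y [^] k \<in> M}" using iff xy by simp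
    qed (use car in auto)
  next
    fix g x assume g: "g \<in> carrier G" and x: "x \<in> {y \<in> B. y [^] k \<in> M}"
    then show "g \<otimes> x \<otimes> inv g \<in> {y \<in> B. y [^] k \<in> M}"
      using normal.inv_op_closed2[OF B g] normal.inv_op_closed2[OF M g]
      by (simp add: conj_nat_pow car)
  qed
qed

end

subsection \<open>Relative lower central series\<close>

text \<open>The subgroup B^k C. Plain products suffice because it is applied with B abelian modulo
  C, where a product of k-th powers is again a k-th power.\<close>

definition pow_mod :: "('a, 'b) monoid_scheme \<Rightarrow> 'a set \<Rightarrow> 'a set \<Rightarrow> nat \<Rightarrow> 'a set" where
  "pow_mod K B C k = {y [^]\<^bsub>K\<^esub> k \<otimes>\<^bsub>K\<^esub> c | y c. y \<in> B \<and> c \<in> C}"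

text \<open>The lower central series of U, computed with the operations of the ambient K. This makes
  normality in K and commutators with elements outside U expressible.\<close>

fun lcs :: "('a, 'b) monoid_scheme \<Rightarrow> 'a set \<Rightarrow> nat \<Rightarrow> 'a set" where
  "lcs K U 0 = U"
| "lcs K U (Suc 0) = U"
| "lcs K U (Suc (Suc i)) =
     generate K {commutator K x y | x y. x \<in> lcs K U (Suc i) \<and> y \<in> U}"

lemma Gamma_eq_lcs: "Gamma K n = lcs K (carrier K) n"
  by (induction n rule: induct_nat_012) simp_all

context group
begin

lemma quotient_eq_iff:
  assumes "M \<lhd> G" "x \<in> carrier G" "y \<in> carrier G"
  shows "M #> x = M #> y \<longleftrightarrow> inv x \<otimes> y \<in> M"
proof -
  interpret q: group_hom G "G Mod M" "\<lambda>x. M #> x" using assms(1) by (rule quotient_hom)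
  have "inv x \<otimes> y \<in> M \<longleftrightarrow> inv\<^bsub>G Mod M\<^esub> (M #> x) \<otimes>\<^bsub>G Mod M\<^esub> (M #> y) = \<one>\<^bsub>G Mod M\<^esub>"
    using quotient_one_iff[OF assms(1), of "inv x \<otimes> y"] assms(2,3) by simp
  also have "\<dots> \<longleftrightarrow> M #> x = M #> y"
    using assms(2,3) q.H.inv_solve_left'[of "M #> x" "M #> y" "\<one>\<^bsub>G Mod M\<^esub>"]
    by (metis q.H.inv_equality q.H.inv_inv q.H.l_inv q.H.inv_closed q.hom_closed)
  finally show ?thesis by simp
qed

lemma commutator_pow:
  assumes "u \<in> carrier G" "p \<in> carrier G"
    and "commutator G u p \<otimes> u = u \<otimes> commutator G u p"
  shows "commutator G (u [^] k) p = commutator G u p [^] (k::nat)"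
proof -
  have "u [^] k \<otimes> commutator G (u [^] k) p = inv p \<otimes> u [^] k \<otimes> p"
    using assms(1,2) by (simp add: commutator_def word_simps)
  also have "\<dots> = (inv p \<otimes> u \<otimes> p) [^] k"
    using conj_nat_pow[of "inv p" u k] assms(1,2) by simp
  also have "inv p \<otimes> u \<otimes> p = u \<otimes> commutator G u p"
    using assms(1,2) by (simp add: commutator_def word_simps)
  also have "(u \<otimes> commutator G u p) [^] k = u [^] k \<otimes> commutator G u p [^] k"
    using assms by (simp add: pow_mult_distrib)
  finally show ?thesis using assms(1,2) by simp
qed

lemma pow_mod_iff:
  assumes "C \<lhd> G" "B \<subseteq> carrier G"
  shows "x \<in> pow_mod G B C k \<longleftrightarrow>
    x \<in> carrier G \<and> (\<exists>y\<in>B. C #> x = (C #> y) [^]\<^bsub>G Mod C\<^esub> k)"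
proof -
  interpret q: group_hom G "G Mod C" "\<lambda>x. C #> x" using assms(1) by (rule quotient_hom)
  have sC: "subgroup C G" using assms(1) normal_imp_subgroup by blast
  show ?thesis
  proof
    assume "x \<in> pow_mod G B C k"
    then obtain y c where y: "y \<in> B" "c \<in> C" "x = y [^] k \<otimes> c" by (auto simp: pow_mod_def)
    then have yc: "y \<in> carrier G" "c \<in> carrier G"
      using assms(2) subgroup.mem_carrier[OF sC] by auto
    then have "C #> (y [^] k) = C #> x"
      using y quotient_eq_iff[OF assms(1), of "y [^] k" x] by (simp add: word_simps)
    then show "x \<in> carrier G \<and> (\<exists>y\<in>B. C #> x = (C #> y) [^]\<^bsub>G Mod C\<^esub> k)"
      using y yc q.hom_nat_pow[of y k] by auto
  next
    assume "x \<in> carrier G \<and> (\<exists>y\<in>B. C #> x = (C #> y) [^]\<^bsub>G Mod C\<^esub> k)"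
    then obtain y where y: "x \<in> carrier G" "y \<in> B" "C #> x = (C #> y) [^]\<^bsub>G Mod C\<^esub> k" by auto
    then have yc: "y \<in> carrier G" using assms(2) by auto
    then have "C #> (y [^] k) = C #> x"
      using y q.hom_nat_pow[of y k] by simp
    then have "inv (y [^] k) \<otimes> x \<in> C"
      using y yc quotient_eq_iff[OF assms(1), of "y [^] k" x] by simp
    moreover have "x = y [^] k \<otimes> (inv (y [^] k) \<otimes> x)" using y yc by (simp add: word_simps)
    ultimately show "x \<in> pow_mod G B C k" using y(2) unfolding pow_mod_def by blast
  qed
qed

text \<open>Since B is abelian modulo C, its k-th powers form a subgroup of the quotient, and the
  set is the preimage of that subgroup.\<close>

lemma normal_pow_mod:
  assumes C: "C \<lhd> G" and B: "B \<lhd> G"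
    and c: "\<And>x y. x \<in> B \<Longrightarrow> y \<in> B \<Longrightarrow> commutator G x y \<in> C"
  shows "pow_mod G B C k \<lhd> G"
proof -
  interpret q: group_hom G "G Mod C" "\<lambda>x. C #> x" using C by (rule quotient_hom)
  have sC: "subgroup C G" and sB: "subgroup B G" using C B normal_imp_subgroup by blast+
  have car: "x \<in> carrier G" if "x \<in> B" for x using subgroup.mem_carrier[OF sB that] .
  note iff = pow_mod_iff[OF C subgroup.subset[OF sB], of _ k]
  show ?thesis
  proof (rule normal_invI)
    show "subgroup (pow_mod G B C k) G"
    proof (rule subgroupI)
      show "pow_mod G B C k \<subseteq> carrier G" using iff by blast
    next
      have "C #> \<one> = (C #> \<one>) [^]\<^bsub>G Mod C\<^esub> k" by simp
      then have "\<one> \<in> pow_mod G B C k" using iff subgroup.one_closed[OF sB] by blast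
      then show "pow_mod G B C k \<noteq> {}" by blast
    next
      fix x assume "x \<in> pow_mod G B C k"
      then obtain y where y: "x \<in> carrier G" "y \<in> B" "C #> x = (C #> y) [^]\<^bsub>G Mod C\<^esub> k"
        using iff by auto
      then have "C #> inv x = (C #> inv y) [^]\<^bsub>G Mod C\<^esub> k"
        using car by (simp add: q.H.nat_pow_inv)
      then show "inv x \<in> pow_mod G B C k" using iff y subgroup.m_inv_closed[OF sB] by auto
    next
      fix x x' assume "x \<in> pow_mod G B C k" "x' \<in> pow_mod G B C k"
      then obtain y y' where y: "x \<in> carrier G" "y \<in> B" "C #> x = (C #> y) [^]\<^bsub>G Mod C\<^esub> k"
        "x' \<in> carrier G" "y' \<in> B" "C #> x' = (C #> y') [^]\<^bsub>G Mod C\<^esub> k"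
        using iff by auto
      have "(C #> y) \<otimes>\<^bsub>G Mod C\<^esub> (C #> y') = (C #> y') \<otimes>\<^bsub>G Mod C\<^esub> (C #> y)"
        using y c[of y y'] car by (simp add: commutator_in_normal_iff[OF C])
      then have "C #> (x \<otimes> x') = (C #> (y \<otimes> y')) [^]\<^bsub>G Mod C\<^esub> k"
        using y car q.H.pow_mult_distrib[of "C #> y" "C #> y'" k] by simp
      then show "x \<otimes> x' \<in> pow_mod G B C k" using iff y subgroup.m_closed[OF sB] by auto
    qed
  next
    fix g x assume g: "g \<in> carrier G" and "x \<in> pow_mod G B C k"
    then obtain y where y: "x \<in> carrier G" "y \<in> B" "C #> x = (C #> y) [^]\<^bsub>G Mod C\<^esub> k"
      using iff by auto
    then have "C #> (g \<otimes> x \<otimes> inv g) = (C #> (g \<otimes> y \<otimes> inv g)) [^]\<^bsub>G Mod C\<^esub> k"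
      using g car q.H.conj_nat_pow[of "C #> g" "C #> y" k] by simp
    then show "g \<otimes> x \<otimes> inv g \<in> pow_mod G B C k"
      using iff y g normal.inv_op_closed2[OF B g] by auto
  qed
qed

text \<open>If p moves y by z^j modulo C, then it moves y^k by z^(jk), because [y,p] lies in B and
  so commutes with y modulo C. With j = 2 each further commutator doubles the exponent, which drives
  the termination argument.\<close>

lemma commutator_pow_mod:
  assumes C: "C \<lhd> G" and B: "B \<lhd> G"
    and c: "\<And>x y. x \<in> B \<Longrightarrow> y \<in> B \<Longrightarrow> commutator G x y \<in> C"
    and sq: "\<And>x. x \<in> B \<Longrightarrow> commutator G x p \<in> pow_mod G B C j"
    and x: "x \<in> pow_mod G B C k" and p: "p \<in> carrier G"
  shows "commutator G x p \<in> pow_mod G B C (j * k)"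
proof -
  interpret q: group_hom G "G Mod C" "\<lambda>x. C #> x" using C by (rule quotient_hom)
  have sC: "subgroup C G" and sB: "subgroup B G" using C B normal_imp_subgroup by blast+
  have car: "x \<in> carrier G" if "x \<in> B" for x using subgroup.mem_carrier[OF sB that] .
  note iff = pow_mod_iff[OF C subgroup.subset[OF sB]]
  obtain y where y: "x \<in> carrier G" "y \<in> B" "C #> x = (C #> y) [^]\<^bsub>G Mod C\<^esub> k"
    using iff x by auto
  obtain z where z: "z \<in> B" "C #> commutator G y p = (C #> z) [^]\<^bsub>G Mod C\<^esub> j"
    using iff sq[OF y(2)] by auto
  have "commutator G y p \<in> B" using commutator_mod_self[OF B y(2) p] by simp
  then have "(C #> commutator G y p) \<otimes>\<^bsub>G Mod C\<^esub> (C #> y) = (C #> y) \<otimes>\<^bsub>G Mod C\<^esub> (C #> commutator G y p)"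
    using y c[of "commutator G y p" y] car p by (simp add: commutator_in_normal_iff[OF C])
  then have "C #> commutator G x p = (C #> commutator G y p) [^]\<^bsub>G Mod C\<^esub> k"
    using y p car q.H.commutator_pow[of "C #> y" "C #> p" k] by (simp add: q.hom_commutator)
  also have "\<dots> = (C #> z) [^]\<^bsub>G Mod C\<^esub> (j * k)"
    using z car by (simp add: q.H.nat_pow_pow)
  finally show ?thesis using iff y z p by auto
qed

text \<open>A conjugate of [x,y] is the commutator of the conjugates, so normality in the whole
  group, and not just in U, passes along the series.\<close>

lemma lcs_normal:
  assumes U: "U \<lhd> G"
  shows "lcs G U n \<lhd> G"
proof (induction n rule: induct_nat_012)
  case (ge2 n)
  have sU: "subgroup U G" and s: "subgroup (lcs G U (Suc n)) G"
    using U ge2 normal_imp_subgroup by blast+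
  have car: "x \<in> carrier G" "y \<in> carrier G" if "x \<in> lcs G U (Suc n)" "y \<in> U" for x y
    using that subgroup.mem_carrier[OF sU] subgroup.mem_carrier[OF s] by auto
  show ?case unfolding lcs.simps
  proof (rule normal_generateI)
    fix h g assume "h \<in> {commutator G x y |x y. x \<in> lcs G U (Suc n) \<and> y \<in> U}"
      and g: "g \<in> carrier G"
    then obtain x y where xy: "h = commutator G x y" "x \<in> lcs G U (Suc n)" "y \<in> U" by auto
    then have "g \<otimes> h \<otimes> inv g = commutator G (g \<otimes> x \<otimes> inv g) (g \<otimes> y \<otimes> inv g)"
      using car[OF xy(2,3)] g by (simp add: commutator_def word_simps)
    then show "g \<otimes> h \<otimes> inv g \<in> {commutator G x y |x y. x \<in> lcs G U (Suc n) \<and> y \<in> U}"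
      using normal.inv_op_closed2[OF ge2(2) g xy(2)] normal.inv_op_closed2[OF U g xy(3)] by blast
  qed (use car in auto)
qed (simp_all add: U)

lemma lcs_subgroup: "U \<lhd> G \<Longrightarrow> subgroup (lcs G U n) G"
  by (rule normal_imp_subgroup[OF lcs_normal])

lemma lcs_commutator:
  assumes "1 \<le> n" "x \<in> lcs G U n" "y \<in> U"
  shows "commutator G x y \<in> lcs G U (Suc n)"
proof (cases n)
  case (Suc m)
  then show ?thesis using assms(2,3) by (simp, intro generate.incl) blast
qed (use assms(1) in simp)

lemma lcs_Suc_least:
  assumes "1 \<le> n" "subgroup S G"
    and "\<And>x y. x \<in> lcs G U n \<Longrightarrow> y \<in> U \<Longrightarrow> commutator G x y \<in> S"
  shows "lcs G U (Suc n) \<subseteq> S"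
proof (cases n)
  case (Suc m)
  have "{commutator G x y |x y. x \<in> lcs G U (Suc m) \<and> y \<in> U} \<subseteq> S"
    using assms(3) Suc by blast
  then show ?thesis using generate_subgroup_incl[OF _ assms(2)] Suc by simp
qed (use assms(1) in simp)

lemma lcs_Suc_subset:
  assumes U: "U \<lhd> G"
  shows "lcs G U (Suc n) \<subseteq> lcs G U n"
proof (cases "n = 0")
  case False
  then show ?thesis
    using lcs_Suc_least[of n "lcs G U n" U] lcs_subgroup[OF U]
      commutator_mod_self(1)[OF lcs_normal[OF U]]
      subgroup.mem_carrier[OF normal_imp_subgroup[OF U]] by simp
qed simp

lemma lcs_antimono: "U \<lhd> G \<Longrightarrow> m \<le> n \<Longrightarrow> lcs G U n \<subseteq> lcs G U m"
  by (rule lift_Suc_antimono_le[of "lcs G U", OF lcs_Suc_subset])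

lemma lcs_subset: "U \<lhd> G \<Longrightarrow> lcs G U n \<subseteq> U"
  using lcs_antimono[of U 0 n] by simp

lemma lcs_mem_carrier: "U \<lhd> G \<Longrightarrow> x \<in> lcs G U n \<Longrightarrow> x \<in> carrier G"
  by (rule subgroup.mem_carrier[OF lcs_subgroup])

lemma lcs_mono:
  assumes "U \<subseteq> V" "V \<lhd> G"
  shows "lcs G U n \<subseteq> lcs G V n"
proof (induction n rule: induct_nat_012)
  case (ge2 n)
  then have "{commutator G x y |x y. x \<in> lcs G U (Suc n) \<and> y \<in> U} \<subseteq>
      {commutator G x y |x y. x \<in> lcs G V (Suc n) \<and> y \<in> V}"
    using assms(1) by blast
  then show ?case unfolding lcs.simps by (rule mono_generate)
qed (use assms in auto)

text \<open>Conjugation by y and by z multiplies x by c = [x,y] and d = [x,z]. Under the hypotheses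
  the two changes commute, so y z and z y conjugate x to the same element, and y z (z y)^-1
  centralizes x. That product is the commutator of the inverses, which explains the inverses in the
  conclusion.\<close>

lemma commutator_commutes:
  assumes car: "x \<in> carrier G" "y \<in> carrier G" "z \<in> carrier G"
    and cz: "commutator G x y \<otimes> z = z \<otimes> commutator G x y"
    and dy: "commutator G x z \<otimes> y = y \<otimes> commutator G x z"
    and cd: "commutator G x y \<otimes> commutator G x z = commutator G x z \<otimes> commutator G x y"
  shows "x \<otimes> commutator G (inv y) (inv z) = commutator G (inv y) (inv z) \<otimes> x"
proof -
  define c d where cd_def: "c = commutator G x y" "d = commutator G x z"
  have cdc: "c \<in> carrier G" "d \<in> carrier G" using car by (simp_all add: cd_def)
  have xy: "x \<otimes> y = y \<otimes> x \<otimes> c" and xz: "x \<otimes> z = z \<otimes> x \<otimes> d"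
    unfolding cd_def using car by (simp_all add: commutator_def word_simps)
  note c = cz[folded cd_def] and d = dy[folded cd_def] and comm = cd[folded cd_def]
  have "x \<otimes> (y \<otimes> z) = (x \<otimes> y) \<otimes> z" using car by (simp add: m_assoc)
  also have "\<dots> = y \<otimes> x \<otimes> (c \<otimes> z)" unfolding xy using car cdc by (simp add: m_assoc)
  also have "\<dots> = y \<otimes> (x \<otimes> z) \<otimes> c" unfolding c using car cdc by (simp add: m_assoc)
  also have "\<dots> = (y \<otimes> z) \<otimes> x \<otimes> (d \<otimes> c)" unfolding xz using car cdc by (simp add: m_assoc)
  finally have 1: "x \<otimes> (y \<otimes> z) = (y \<otimes> z) \<otimes> x \<otimes> (d \<otimes> c)" .
  have "x \<otimes> (z \<otimes> y) = (x \<otimes> z) \<otimes> y" using car by (simp add: m_assoc)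
  also have "\<dots> = z \<otimes> x \<otimes> (d \<otimes> y)" unfolding xz using car cdc by (simp add: m_assoc)
  also have "\<dots> = z \<otimes> (x \<otimes> y) \<otimes> d" unfolding d using car cdc by (simp add: m_assoc)
  also have "\<dots> = (z \<otimes> y) \<otimes> x \<otimes> (c \<otimes> d)" unfolding xy using car cdc by (simp add: m_assoc)
  finally have 2: "x \<otimes> (z \<otimes> y) = (z \<otimes> y) \<otimes> x \<otimes> (d \<otimes> c)" unfolding comm .
  define u v where uv: "u = y \<otimes> z" "v = z \<otimes> y"
  have uvc: "u \<in> carrier G" "v \<in> carrier G" using car uv by simp_all
  have u: "inv u \<otimes> x \<otimes> u = x \<otimes> (d \<otimes> c)" and v: "inv v \<otimes> x \<otimes> v = x \<otimes> (d \<otimes> c)"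
    using 1 2 car cdc uvc unfolding uv[symmetric] by (simp_all add: m_assoc mult_inv_cancel_left)
  have "x \<otimes> (u \<otimes> inv v) = u \<otimes> (inv u \<otimes> x \<otimes> u) \<otimes> inv v"
    using uvc car by (simp add: word_simps)
  also have "\<dots> = u \<otimes> inv v \<otimes> x"
    unfolding u v[symmetric] using uvc car by (simp add: word_simps)
  finally show ?thesis
    using car by (simp add: uv commutator_def word_simps)
qed

text \<open>Conjugation by elements of \<open>U\<close> acts on \<open>lcs G U k\<close> modulo \<open>lcs G U (k + 2)\<close>
  by commuting transformations.\<close>
lemma lcs_commutator_2:
  assumes U: "U \<lhd> G" and k: "1 \<le> k" and x: "x \<in> lcs G U k" and w: "w \<in> lcs G U 2"
  shows "commutator G x w \<in> lcs G U (k + 2)"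
proof -
  obtain M where M_eq: "M = lcs G U (k + 2)" by simp
  have M: "M \<lhd> G" unfolding M_eq using lcs_normal[OF U] .
  interpret q: group_hom G "G Mod M" "\<lambda>x. M #> x" using M by (rule quotient_hom)
  have sU: "subgroup U G" using U normal_imp_subgroup by blast
  have xc: "x \<in> carrier G" using lcs_mem_carrier[OF U x] .
  have basic: "commutator G x (commutator G (inv y) (inv z)) \<in> M" if y: "y \<in> U" and z: "z \<in> U" for y z
  proof -
    have yzc: "y \<in> carrier G" "z \<in> carrier G" using y z subgroup.mem_carrier[OF sU] by auto
    have c1: "commutator G x y \<in> lcs G U (Suc k)" "commutator G x z \<in> lcs G U (Suc k)"
      using lcs_commutator[OF k x] y z by auto
    have com: "(M #> c) \<otimes>\<^bsub>G Mod M\<^esub> (M #> u) = (M #> u) \<otimes>\<^bsub>G Mod M\<^esub> (M #> c)"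
      if c: "c \<in> lcs G U (Suc k)" and u: "u \<in> U" for c u
    proof -
      have "commutator G c u \<in> M" using lcs_commutator[OF _ c u] by (simp add: M_eq)
      then show ?thesis
        using commutator_in_normal_iff[OF M] lcs_mem_carrier[OF U c] subgroup.mem_carrier[OF sU u]
        by simp
    qed
    have inU: "commutator G x z \<in> U" using c1(2) lcs_subset[OF U] by blast
    show ?thesis
      using q.H.commutator_commutes[of "M #> x" "M #> y" "M #> z"]
        com[OF c1(1) z] com[OF c1(2) y] com[OF c1(1) inU] xc yzc
      by (simp add: q.hom_commutator commutator_in_normal_iff[OF M])
  qed
  have "lcs G U (Suc 1) \<subseteq> {w \<in> carrier G. \<forall>u\<in>{x}. commutator G u w \<in> M}"
  proof (rule lcs_Suc_least[OF _ subgroup_commutator_in[OF M]])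
    fix y z assume "y \<in> lcs G U 1" and z: "z \<in> U"
    then have y: "y \<in> U" by simp
    then have yzc: "y \<in> carrier G" "z \<in> carrier G" using z subgroup.mem_carrier[OF sU] by auto
    show "commutator G y z \<in> {w \<in> carrier G. \<forall>u\<in>{x}. commutator G u w \<in> M}"
      using basic[of "inv y" "inv z"] y z yzc subgroup.m_inv_closed[OF sU] by simp
  qed (use xc in auto)
  then show ?thesis using w by (auto simp: numeral_2_eq_2 M_eq)
qed

end

subsection \<open>The lower central series of an abstract Klein bottle extension\<close>

context group
begin

lemma normal_closure_normal:
  assumes "V \<subseteq> carrier G" shows "normal_closure G V \<lhd> G"
  unfolding normal_closure_def
proof (rule normal_generateI)
  fix h g assume "h \<in> {g \<otimes> s \<otimes> inv g |g s. g \<in> carrier G \<and> s \<in> V}" and g: "g \<in> carrier G"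
  then obtain k s where ks: "h = k \<otimes> s \<otimes> inv k" "k \<in> carrier G" "s \<in> V" by blast
  then have "g \<otimes> h \<otimes> inv g = (g \<otimes> k) \<otimes> s \<otimes> inv (g \<otimes> k)"
    using assms g by (simp add: word_simps subset_iff)
  then show "g \<otimes> h \<otimes> inv g \<in> {g \<otimes> s \<otimes> inv g |g s. g \<in> carrier G \<and> s \<in> V}"
    using g ks(2,3) by blast
qed (use assms in auto)

lemma normal_closure_incl:
  assumes "V \<subseteq> carrier G" "x \<in> V" shows "x \<in> normal_closure G V"
proof -
  have "x = \<one> \<otimes> x \<otimes> inv \<one>" using assms by auto
  then show ?thesis unfolding normal_closure_def using assms(2) by (blast intro: generate.incl)
qed

lemma normal_closure_least:
  assumes "M \<lhd> G" "V \<subseteq> M" shows "normal_closure G V \<subseteq> M"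
  unfolding normal_closure_def
proof (rule generate_subgroup_incl)
  show "{g \<otimes> s \<otimes> inv g |g s. g \<in> carrier G \<and> s \<in> V} \<subseteq> M"
    using normal.inv_op_closed2[OF assms(1)] assms(2) by auto
qed (rule normal_imp_subgroup[OF assms(1)])

lemma normal_join:
  assumes A: "A \<lhd> G" and B: "B \<lhd> G"
  shows "generate G (A \<union> B) \<lhd> G"
proof (rule normal_generateI)
  show "A \<union> B \<subseteq> carrier G"
    using subgroup.subset[OF normal_imp_subgroup[OF A]] subgroup.subset[OF normal_imp_subgroup[OF B]]
    by blast
qed (use normal.inv_op_closed2[OF A] normal.inv_op_closed2[OF B] in auto)

lemma commutator_self: "x \<in> carrier G \<Longrightarrow> commutator G x x = \<one>"
  by (simp add: commutator_eq_one_iff)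

lemma pow_two: "x \<in> carrier G \<Longrightarrow> x [^] (2::nat) = x \<otimes> x"
  by (simp add: numeral_2_eq_2)

lemma pow_two_power_Suc:
  "x \<in> carrier G \<Longrightarrow> x [^] ((2::nat) ^ Suc k) = x [^] ((2::nat) ^ k) \<otimes> x [^] ((2::nat) ^ k)"
  by (simp add: nat_pow_mult mult_2)

text \<open>Conjugation by p turns [x,y] into [x r, y r'] with r = [x,p] and r' = [y,p]. The
  hypotheses allow r and r' to be gathered into a factor that commutes with [x,y]. They are
  asymmetric because in the application x lies deep in the series while y is arbitrary in U, so r'
  is controlled against x but not against y.\<close>

lemma commutator_fixed:
  assumes car: "x \<in> carrier G" "y \<in> carrier G" "p \<in> carrier G"
    and "commutator G x p \<otimes> x = x \<otimes> commutator G x p"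
    and "commutator G x p \<otimes> y = y \<otimes> commutator G x p"
    and "commutator G x p \<otimes> commutator G y p = commutator G y p \<otimes> commutator G x p"
    and "x \<otimes> commutator G y p = commutator G y p \<otimes> x"
    and "commutator G x y \<otimes> commutator G y p = commutator G y p \<otimes> commutator G x y"
  shows "commutator G x y \<otimes> p = p \<otimes> commutator G x y"
proof -
  define r r' where rr: "r = commutator G x p" "r' = commutator G y p"
  have rc: "r \<in> carrier G" "r' \<in> carrier G" using car by (simp_all add: rr)
  note com = assms(4-8)[folded rr]
  have x: "inv p \<otimes> x \<otimes> p = x \<otimes> r" and y: "inv p \<otimes> y \<otimes> p = y \<otimes> r'"
    unfolding rr using car by (simp_all add: commutator_def word_simps)
  have "inv p \<otimes> commutator G x y \<otimes> p =
      commutator G (inv p \<otimes> x \<otimes> p) (inv p \<otimes> y \<otimes> p)"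
    using car by (simp add: commutator_def word_simps)
  also have "\<dots> = inv (x \<otimes> r) \<otimes> inv (y \<otimes> r') \<otimes> x \<otimes> (r \<otimes> y) \<otimes> r'"
    unfolding x y using car rc by (simp add: commutator_def word_simps)
  also have "r \<otimes> y = y \<otimes> r" by (rule com)
  also have "inv (x \<otimes> r) \<otimes> inv (y \<otimes> r') \<otimes> x \<otimes> (y \<otimes> r) \<otimes> r' =
     inv (y \<otimes> r' \<otimes> (x \<otimes> r)) \<otimes> x \<otimes> y \<otimes> (r \<otimes> r')"
    using car rc by (simp add: word_simps)
  also have "y \<otimes> r' \<otimes> (x \<otimes> r) = y \<otimes> (x \<otimes> r') \<otimes> r"
    unfolding com(4) using car rc by (simp add: m_assoc)
  also have "\<dots> = y \<otimes> x \<otimes> (r \<otimes> r')"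
    unfolding com(3) using car rc by (simp add: m_assoc)
  also have "inv (y \<otimes> x \<otimes> (r \<otimes> r')) \<otimes> x \<otimes> y \<otimes> (r \<otimes> r') =
     inv (r \<otimes> r') \<otimes> (commutator G x y \<otimes> (r \<otimes> r'))"
    using car rc by (simp add: word_simps commutator_def)
  also have "commutator G x y \<otimes> (r \<otimes> r') = (r \<otimes> r') \<otimes> commutator G x y"
  proof -
    have "r \<otimes> (x \<otimes> y) = x \<otimes> y \<otimes> r"
      by (metis car(1,2) com(1,2) m_assoc rc(1))
    moreover have "r \<otimes> (y \<otimes> x) = y \<otimes> x \<otimes> r"
      by (metis car(1,2) com(1,2) m_assoc rc(1))
    moreover have "commutator G x y = inv (y \<otimes> x) \<otimes> (x \<otimes> y)"
      using car by (simp add: commutator_def word_simps)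
    ultimately have "r \<otimes> commutator G x y = commutator G x y \<otimes> r"
      using subgroup.m_closed[OF subgroup_commuting[of "{r}"], of "inv (y \<otimes> x)" "x \<otimes> y"]
        subgroup.m_inv_closed[OF subgroup_commuting[of "{r}"], of "y \<otimes> x"] car rc by auto
    then show ?thesis
      using com(5) car rc by (metis commutator_closed m_assoc)
  qed
  finally have "inv p \<otimes> commutator G x y \<otimes> p = commutator G x y"
    using car rc by (simp add: word_simps)
  then have "p \<otimes> (inv p \<otimes> commutator G x y \<otimes> p) = p \<otimes> commutator G x y" by simp
  then show ?thesis using car by (simp add: word_simps)
qed

end

text \<open>Here \<open>a\<close>, \<open>b\<close> stand for the free generators and
  \<open>s\<close>, \<open>t\<close> for \<alpha>, \<beta>. Each relation writes the action of
  \<open>s\<close> or \<open>t\<close> as a rule for moving it to the right. The lower central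
  series is computed from these assumptions alone.\<close>

locale klein = group +
  fixes U :: "'a set" and a b s t :: 'a
  assumes gens_closed [simp]: "a \<in> carrier G" "b \<in> carrier G" "s \<in> carrier G" "t \<in> carrier G"
    and U_normal: "U \<lhd> G"
    and U_gen: "U = generate G {a, b}"
    and G_gen: "carrier G = generate G {a, b, s, t}"
    and sa: "s \<otimes> a = a \<otimes> s"
    and sb: "s \<otimes> b = inv a \<otimes> inv a \<otimes> b \<otimes> s"
    and ta: "t \<otimes> a = inv a \<otimes> t"
    and tb: "t \<otimes> b = a \<otimes> b \<otimes> a \<otimes> t"
    and ts: "t \<otimes> s = inv s \<otimes> t"
begin

definition lower :: "nat \<Rightarrow> 'a set" where "lower n = lcs G (carrier G) n"
definition fibre :: "nat \<Rightarrow> 'a set" where "fibre n = lcs G U n"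

definition powers :: "nat \<Rightarrow> 'a set" where
  "powers n = {a [^] ((2::nat) ^ (n - 1))} \<union>
     {x [^] ((2::nat) ^ (n - i)) | x i. 2 \<le> i \<and> i \<le> n \<and> x \<in> fibre i}"

definition closure_term :: "nat \<Rightarrow> 'a set" where
  "closure_term n = normal_closure G (insert (s [^] ((2::nat) ^ (n - 1))) (powers n))"

definition central_mod :: "'a set \<Rightarrow> 'a set" where
  "central_mod M = {x \<in> carrier G. \<forall>p\<in>carrier G. commutator G x p \<in> M}"

lemmas lower_normal = lcs_normal[OF normal_self, folded lower_def]
lemmas fibre_normal = lcs_normal[OF U_normal, folded fibre_def]
lemmas lower_subgroup = normal_imp_subgroup[OF lower_normal]
lemmas fibre_subgroup = normal_imp_subgroup[OF fibre_normal]
lemmas lower_car = subgroup.mem_carrier[OF lower_subgroup]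
lemmas fibre_car = subgroup.mem_carrier[OF fibre_subgroup]
lemmas U_car = subgroup.mem_carrier[OF normal_imp_subgroup[OF U_normal]]
lemmas lower_antimono = lcs_antimono[OF normal_self, folded lower_def]
lemmas fibre_antimono = lcs_antimono[OF U_normal, folded fibre_def]
lemmas fibre_U = lcs_subset[OF U_normal, folded fibre_def]
lemmas lower_commutator = lcs_commutator[of _ _ "carrier G", folded lower_def]
lemmas fibre_commutator = lcs_commutator[of _ _ U, folded fibre_def]
lemmas lower_commutator_2 = lcs_commutator_2[OF normal_self, folded lower_def]
lemmas fibre_commutator_2 = lcs_commutator_2[OF U_normal, folded fibre_def]
lemmas lower_least = lcs_Suc_least[of _ _ "carrier G", folded lower_def]
lemmas fibre_least = lcs_Suc_least[of _ _ U, folded fibre_def]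

lemma lower_1 [simp]: "lower (Suc 0) = carrier G" by (simp add: lower_def)
lemma fibre_1 [simp]: "fibre (Suc 0) = U" by (simp add: fibre_def)

lemma fibre_lower: "fibre n \<subseteq> lower n"
  unfolding fibre_def lower_def
  using lcs_mono[OF subgroup.subset[OF normal_imp_subgroup[OF U_normal]] normal_self] .

lemma powers_closed: "insert (s [^] ((2::nat) ^ (n - 1))) (powers n) \<subseteq> carrier G"
  unfolding powers_def using fibre_car by auto

lemmas closure_term_normal = normal_closure_normal[OF powers_closed, folded closure_term_def]
lemmas closure_term_incl = normal_closure_incl[OF powers_closed, folded closure_term_def]
lemmas closure_term_subgroup = normal_imp_subgroup[OF closure_term_normal]

lemma a_pow_closure_term: "a [^] ((2::nat) ^ (n - 1)) \<in> closure_term n"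
  by (rule closure_term_incl) (simp add: powers_def)
lemma s_pow_closure_term: "s [^] ((2::nat) ^ (n - 1)) \<in> closure_term n"
  by (rule closure_term_incl) simp
lemma fibre_pow_closure_term:
  "2 \<le> i \<Longrightarrow> i \<le> n \<Longrightarrow> x \<in> fibre i \<Longrightarrow> x [^] ((2::nat) ^ (n - i)) \<in> closure_term n"
  by (rule closure_term_incl) (auto simp: powers_def)

lemma fibre_closure_term: "2 \<le> n \<Longrightarrow> fibre n \<subseteq> closure_term n"
  using fibre_pow_closure_term[of n n] fibre_car by force

lemma closure_term_least:
  assumes "M \<lhd> G" "a [^] ((2::nat) ^ (n - 1)) \<in> M" "s [^] ((2::nat) ^ (n - 1)) \<in> M"
    and "\<And>x i. 2 \<le> i \<Longrightarrow> i \<le> n \<Longrightarrow> x \<in> fibre i \<Longrightarrow> x [^] ((2::nat) ^ (n - i)) \<in> M"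
  shows "closure_term n \<subseteq> M"
  unfolding closure_term_def
  by (rule normal_closure_least[OF assms(1)]) (use assms in \<open>auto simp: powers_def\<close>)

lemmas central_mod_normal = normal_commutator_in[folded central_mod_def]

lemma central_modI:
  assumes M: "M \<lhd> G" and x: "x \<in> carrier G"
    and p: "\<And>p. p \<in> {a, b, s, t} \<Longrightarrow> commutator G x p \<in> M"
  shows "x \<in> central_mod M"
proof -
  have "commutator G x p \<in> M" if "p \<in> carrier G" for p
    by (rule commutator_generate[OF M, of "{x}" "{a, b, s, t}"])
       (use x p that G_gen in \<open>auto intro: generate.incl\<close>)
  then show ?thesis using x by (simp add: central_mod_def)
qed

lemma lower_step:
  assumes "1 \<le> n" "M \<lhd> G" "lower n \<subseteq> central_mod M"
  shows "lower (Suc n) \<subseteq> M"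
  by (rule lower_least[OF assms(1) normal_imp_subgroup[OF assms(2)]])
     (use assms(3) in \<open>auto simp: central_mod_def\<close>)

lemma normal_central_mod: "M \<lhd> G \<Longrightarrow> M \<subseteq> central_mod M"
  unfolding central_mod_def using commutator_mod_self(1)[of M]
    subgroup.mem_carrier[OF normal_imp_subgroup[of M]] by blast

section \<open>Commutators of powers of the generators\<close>

lemma a_pow_conj_t: "t \<otimes> a [^] (k::nat) = inv (a [^] k) \<otimes> t"
proof -
  have "t \<otimes> a \<otimes> inv t = inv a" using ta by (simp add: m_assoc)
  then have "t \<otimes> a [^] k \<otimes> inv t = inv a [^] k" using conj_nat_pow[of t a k] by simp
  then have "t \<otimes> a [^] k \<otimes> inv t \<otimes> t = inv (a [^] k) \<otimes> t" by (simp add: nat_pow_inv)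
  then show ?thesis by (simp add: word_simps)
qed

lemma s_pow_conj_t: "t \<otimes> s [^] (k::nat) = inv (s [^] k) \<otimes> t"
proof -
  have "t \<otimes> s \<otimes> inv t = inv s" using ts by (simp add: m_assoc)
  then have "t \<otimes> s [^] k \<otimes> inv t = inv s [^] k" using conj_nat_pow[of t s k] by simp
  then have "t \<otimes> s [^] k \<otimes> inv t \<otimes> t = inv (s [^] k) \<otimes> t" by (simp add: nat_pow_inv)
  then show ?thesis by (simp add: word_simps)
qed

text \<open>If t x t^-1 = x^-1, then also t^-1 x t = x^-1, whence [x,t] = x^-2. For \<open>a\<close>
  and \<open>s\<close> this is the source of the powers of 2.\<close>

lemma commutator_inverted:
  assumes x: "x \<in> carrier G" and "t \<otimes> x = inv x \<otimes> t"
  shows "commutator G x t = inv (x \<otimes> x)"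
proof -
  have "inv x \<otimes> inv t = inv (t \<otimes> x)" using x by (simp add: inv_mult_group)
  also have "\<dots> = inv t \<otimes> x" unfolding assms(2) using x by (simp add: inv_mult_group)
  finally have *: "inv x \<otimes> inv t = inv t \<otimes> x" .
  have "inv t \<otimes> x = inv x \<otimes> inv t" by (simp add: *)
  then have "inv t \<otimes> x \<otimes> t = inv x" using x by (simp add: m_assoc)
  then show ?thesis using x by (simp add: commutator_def word_simps)
qed

lemma a_pow_t: "commutator G (a [^] (2::nat) ^ k) t = inv (a [^] ((2::nat) ^ Suc k))"
  using commutator_inverted[OF _ a_pow_conj_t] pow_two_power_Suc by simp

lemma s_pow_t: "commutator G (s [^] (2::nat) ^ k) t = inv (s [^] ((2::nat) ^ Suc k))"
  using commutator_inverted[OF _ s_pow_conj_t] pow_two_power_Suc by simp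

lemma a_pow_s: "commutator G (a [^] (k::nat)) s = \<one>"
  using pow_mult_distrib commutator_eq_one_iff commutator_pow[of a s k]
  by (simp add: commutator_eq_one_iff[THEN iffD2] sa)

lemma s_pow_a: "commutator G (s [^] (k::nat)) a = \<one>"
  using commutator_pow[of s a k]
  by (simp add: commutator_eq_one_iff[THEN iffD2] sa)

lemma s_pow_conj_b: "s [^] (k::nat) \<otimes> b = inv (a [^] k) \<otimes> inv (a [^] k) \<otimes> b \<otimes> s [^] k"
proof (induction k)
  case (Suc k)
  have c: "s [^] k \<otimes> inv a = inv a \<otimes> s [^] k"
  proof -
    have "s [^] k \<otimes> a = a \<otimes> s [^] k" using s_pow_a[of k] by (simp add: commutator_eq_one_iff)
    then show ?thesis by (simp add: inv_solve_left inv_solve_right m_assoc)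
        (metis gens_closed(1,3) inv_closed inv_solve_right m_assoc m_closed nat_pow_closed)
  qed
  have d: "inv a \<otimes> inv (a [^] k) = inv (a [^] k) \<otimes> inv a"
    by (metis gens_closed(1) inv_mult_group nat_pow_closed nat_pow_Suc nat_pow_Suc2)
  have "s [^] Suc k \<otimes> b = s [^] k \<otimes> (s \<otimes> b)" by (simp add: m_assoc)
  also have "\<dots> = (s [^] k \<otimes> inv a) \<otimes> inv a \<otimes> b \<otimes> s" unfolding sb by (simp add: m_assoc)
  also have "(s [^] k \<otimes> inv a) \<otimes> inv a = inv a \<otimes> (s [^] k \<otimes> inv a)" by (subst c) (simp add: m_assoc)
  also have "inv a \<otimes> (s [^] k \<otimes> inv a) \<otimes> b \<otimes> s = inv a \<otimes> inv a \<otimes> (s [^] k \<otimes> b) \<otimes> s"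
    by (subst c) (simp add: m_assoc)
  also have "\<dots> = inv a \<otimes> (inv a \<otimes> inv (a [^] k)) \<otimes> inv (a [^] k) \<otimes> b \<otimes> s [^] Suc k"
    unfolding Suc by (simp add: m_assoc)
  also have "\<dots> = (inv a \<otimes> inv (a [^] k)) \<otimes> (inv a \<otimes> inv (a [^] k)) \<otimes> b \<otimes> s [^] Suc k"
    by (subst d) (simp add: m_assoc)
  also have "inv a \<otimes> inv (a [^] k) = inv (a [^] Suc k)" by (simp add: inv_mult_group)
  finally show ?case .
qed simp

text \<open>s^k moves b by a^(-2k), so the commutator is a conjugate of the inverse of a^(2^(k+1)).
  The exponent of \<open>a\<close> is one doubling ahead of that of \<open>s\<close>.\<close>

lemma s_pow_b:
  assumes M: "M \<lhd> G" and "a [^] ((2::nat) ^ Suc k) \<in> M"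
  shows "commutator G (s [^] (2::nat) ^ k) b \<in> M"
proof -
  let ?k = "(2::nat) ^ k"
  have "commutator G (s [^] ?k) b = inv (b \<otimes> s [^] ?k) \<otimes> (s [^] ?k \<otimes> b)"
    by (simp add: commutator_def word_simps)
  also have "\<dots> = inv (b \<otimes> s [^] ?k) \<otimes> inv (a [^] ((2::nat) ^ Suc k)) \<otimes> inv (inv (b \<otimes> s [^] ?k))"
    unfolding s_pow_conj_b pow_two_power_Suc[OF gens_closed(1)] by (simp add: word_simps)
  finally show ?thesis
    using normal.inv_op_closed2[OF M, of "inv (b \<otimes> s [^] ?k)"]
      subgroup.m_inv_closed[OF normal_imp_subgroup[OF M] assms(2)] by simp
qed

text \<open>The relations give t^-1 b t = a b a, so [b,t] = b^-1 a b a. Splitting off a^2 leaves a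
  commutator inside U, which shows that t fixes b modulo squares and commutators of U.\<close>

lemma b_t: "commutator G b t = commutator G b (inv a) \<otimes> (a \<otimes> a)"
proof -
  have "t \<otimes> (a \<otimes> b \<otimes> a) = (t \<otimes> a) \<otimes> b \<otimes> a" by (simp add: m_assoc)
  also have "\<dots> = inv a \<otimes> (t \<otimes> b) \<otimes> a" unfolding ta by (simp add: m_assoc)
  also have "\<dots> = b \<otimes> a \<otimes> (t \<otimes> a)" unfolding tb by (simp add: word_simps)
  also have "\<dots> = b \<otimes> t" unfolding ta by (simp add: word_simps)
  finally have "b \<otimes> t = t \<otimes> (a \<otimes> b \<otimes> a)" by simp
  then have "inv b \<otimes> inv t \<otimes> (b \<otimes> t) = inv b \<otimes> inv t \<otimes> (t \<otimes> (a \<otimes> b \<otimes> a))" by simp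
  then show ?thesis by (simp add: commutator_def word_simps)
qed


lemma lower_2_closure_term: "lower 2 \<subseteq> closure_term 2"
proof -
  let ?M = "closure_term 2"
  have M: "?M \<lhd> G" by (rule closure_term_normal)
  note sM = normal_imp_subgroup[OF M]
  have sw: "commutator G y x \<in> ?M" if "x \<in> carrier G" "y \<in> carrier G" "commutator G x y \<in> ?M" for x y
    using commutator_swap_in[OF sM that] .
  have one: "\<one> \<in> ?M" by (rule subgroup.one_closed[OF sM])
  have a2: "a \<otimes> a \<in> ?M" using a_pow_closure_term[of 2] pow_two by simp
  have s2: "s \<otimes> s \<in> ?M" using s_pow_closure_term[of 2] pow_two by simp
  have ab: "commutator G a b \<in> ?M" and bai: "commutator G b (inv a) \<in> ?M"
  proof -
    have U: "a \<in> U" "b \<in> U" unfolding U_gen by (auto intro: generate.incl)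
    then have "inv a \<in> U" using subgroup.m_inv_closed[OF normal_imp_subgroup[OF U_normal]] by simp
    then have "commutator G a b \<in> fibre 2" "commutator G b (inv a) \<in> fibre 2"
      using U fibre_commutator[of 1] by (simp_all add: numeral_2_eq_2)
    then show "commutator G a b \<in> ?M" "commutator G b (inv a) \<in> ?M"
      using fibre_closure_term[of 2] by auto
  qed
  have at: "commutator G a t \<in> ?M"
    using a_pow_t[of 0] a2 subgroup.m_inv_closed[OF sM] pow_two by simp
  have st: "commutator G s t \<in> ?M"
    using s_pow_t[of 0] s2 subgroup.m_inv_closed[OF sM] pow_two by simp
  have bt: "commutator G b t \<in> ?M"
    unfolding b_t using subgroup.m_closed[OF sM bai a2] .
  have as: "commutator G a s \<in> ?M" using a_pow_s[of 1] one by simp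
  have sb': "commutator G s b \<in> ?M" using s_pow_b[OF M, of 0] a2 pow_two by simp
  have gens: "commutator G x y \<in> ?M" if "x \<in> {a, b, s, t}" "y \<in> {a, b, s, t}" for x y
    using that ab at st bt as sb' sw one by (auto simp: commutator_self)
  have "commutator G x y \<in> ?M" if "x \<in> carrier G" "y \<in> carrier G" for x y
    by (rule commutator_generate[OF M _ _ gens, of "{a, b, s, t}" "{a, b, s, t}"])
       (use that[unfolded G_gen] in simp_all)
  then show ?thesis using lower_least[of 1 ?M] sM by (simp add: numeral_2_eq_2)
qed

section \<open>Squaring along the lower central series\<close>

lemma a_square_lower: "a [^] ((2::nat) ^ Suc 0) \<in> lower 2"
proof -
  have "commutator G a t \<in> lower 2" using lower_commutator[of 1 a t] by (simp add: numeral_2_eq_2)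
  then have "inv (a [^] ((2::nat) ^ Suc 0)) \<in> lower 2" using a_pow_t[of 0] by simp
  then show ?thesis using subgroup.m_inv_closed[OF lower_subgroup] by fastforce
qed

lemma s_square_lower: "s [^] ((2::nat) ^ Suc 0) \<in> lower 2"
proof -
  have "commutator G s t \<in> lower 2" using lower_commutator[of 1 s t] by (simp add: numeral_2_eq_2)
  then have "inv (s [^] ((2::nat) ^ Suc 0)) \<in> lower 2" using s_pow_t[of 0] by simp
  then show ?thesis using subgroup.m_inv_closed[OF lower_subgroup] by fastforce
qed

text \<open>Base case of exponent two, checked on the normal generators of
  \<open>closure_term 2\<close>. For a^2 and s^2, the squares are the inverses of [a^2,t] and
  [s^2,t]. For \<open>fibre 2\<close> it suffices to treat [a,b], whose square agrees with [a^2,b]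
  modulo \<Gamma>_3.\<close>

lemma lower_2_square: "lower 2 \<subseteq> {y \<in> lower 2. y [^] (2::nat) \<in> lower 3}"
proof -
  let ?W = "{y \<in> lower 2. y [^] (2::nat) \<in> lower 3}"
  have W: "?W \<lhd> G"
    by (rule normal_pow_in[OF lower_normal lower_normal])
      (use lower_commutator[of 2] lower_car in \<open>auto simp: numeral_eq_Suc\<close>)
  have inv_mem: "x \<in> lower k" if "inv x \<in> lower k" "x \<in> carrier G" for x k
    using subgroup.m_inv_closed[OF lower_subgroup that(1)] that(2) by simp
  have a: "a [^] ((2::nat) ^ Suc 0) \<in> ?W"
  proof -
    have "commutator G (a [^] ((2::nat) ^ Suc 0)) t \<in> lower 3"
      using lower_commutator[OF _ a_square_lower] by (simp add: numeral_eq_Suc)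
    then have "a [^] ((2::nat) ^ Suc (Suc 0)) \<in> lower 3"
      unfolding a_pow_t by (rule inv_mem) simp
    then show ?thesis using a_square_lower by (simp add: nat_pow_pow)
  qed
  have s: "s [^] ((2::nat) ^ Suc 0) \<in> ?W"
  proof -
    have "commutator G (s [^] ((2::nat) ^ Suc 0)) t \<in> lower 3"
      using lower_commutator[OF _ s_square_lower] by (simp add: numeral_eq_Suc)
    then have "s [^] ((2::nat) ^ Suc (Suc 0)) \<in> lower 3"
      unfolding s_pow_t by (rule inv_mem) simp
    then show ?thesis using s_square_lower by (simp add: nat_pow_pow)
  qed
  have ab: "commutator G a b \<in> ?W"
  proof -
    have ab: "commutator G a b \<in> lower 2" using lower_commutator[of 1 a b] by (simp add: numeral_2_eq_2)
    then have "commutator G (commutator G a b) a \<in> lower 3"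
      using lower_commutator[of 2] by (simp add: numeral_eq_Suc)
    moreover have "commutator G (a \<otimes> a) b \<in> lower 3"
      using lower_commutator[OF _ a_square_lower, of b] pow_two by (simp add: numeral_3_eq_3)
    ultimately have "commutator G a b \<otimes> commutator G a b \<in> lower 3"
      using commutator_square_mod[OF lower_normal] by simp
    then show ?thesis using ab pow_two by simp
  qed
  note sW = normal_imp_subgroup[OF W]
  have gens: "commutator G x y \<in> ?W" if "x \<in> {a, b}" "y \<in> {a, b}" for x y
    using that ab commutator_swap_in[OF sW _ _ ab] subgroup.one_closed[OF sW]
    by (elim insertE emptyE) (simp_all only: commutator_self gens_closed)
  have "commutator G x y \<in> ?W" if "x \<in> U" "y \<in> U" for x y
    by (rule commutator_generate[OF W _ _ gens, of "{a, b}" "{a, b}"])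
       (use that[unfolded U_gen] in simp_all)
  then have F: "fibre 2 \<subseteq> ?W"
    using fibre_least[of 1 ?W] sW by (simp add: numeral_2_eq_2)
  have "closure_term 2 \<subseteq> ?W"
  proof (rule closure_term_least[OF W])
    fix x i assume "2 \<le> i" "i \<le> (2::nat)" "x \<in> fibre i"
    then show "x [^] ((2::nat) ^ (2 - i)) \<in> ?W" using F fibre_car by auto
  qed (use a s in simp_all)
  then show ?thesis using lower_2_closure_term by blast
qed

text \<open>If x^2 is in \<Gamma>_(n+1), then [x^2,p] is in \<Gamma>_(n+2). Modulo this term it
  equals [x,p]^2, because [[x,p],x] lies there too. So exponent two passes from one quotient to the
  next.\<close>

lemma lower_square:
  assumes "2 \<le> n" "x \<in> lower n" shows "x \<otimes> x \<in> lower (Suc n)"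
  using assms
proof (induction n arbitrary: x rule: nat_induct_at_least)
  case base
  then have "x [^] (2::nat) \<in> lower 3" using lower_2_square by blast
  then show ?case using pow_two lower_car[OF base] by (simp add: numeral_eq_Suc)
next
  case (Suc n)
  let ?W = "{y \<in> lower (Suc n). y [^] (2::nat) \<in> lower (Suc (Suc n))}"
  have W: "?W \<lhd> G"
    by (rule normal_pow_in[OF lower_normal lower_normal])
      (use lower_commutator[of "Suc n"] lower_car in auto)
  have "lower (Suc n) \<subseteq> ?W"
  proof (rule lower_least[OF _ normal_imp_subgroup[OF W]])
    fix x p assume x: "x \<in> lower n" and p: "p \<in> carrier G"
    have xc: "x \<in> carrier G" using x lower_car by blast
    have xp: "commutator G x p \<in> lower (Suc n)"
      using lower_commutator[OF _ x p] Suc.hyps by simp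
    then have "commutator G (commutator G x p) x \<in> lower (Suc (Suc n))"
      using lower_commutator[OF _ xp xc] by simp
    moreover have "commutator G (x \<otimes> x) p \<in> lower (Suc (Suc n))"
      using lower_commutator[OF _ Suc.IH[OF x] p] by simp
    ultimately have "commutator G x p \<otimes> commutator G x p \<in> lower (Suc (Suc n))"
      using commutator_square_mod[OF lower_normal xc p] by simp
    then show "commutator G x p \<in> ?W" using xp xc p pow_two by simp
  qed (use Suc.hyps in simp)
  then have "x [^] (2::nat) \<in> lower (Suc (Suc n))" using Suc.prems by blast
  then show ?case using pow_two lower_car[OF Suc.prems] by simp
qed

lemma lower_pow:
  assumes "2 \<le> n" "x \<in> lower n" shows "x [^] ((2::nat) ^ k) \<in> lower (n + k)"
proof (induction k)
  case (Suc k)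
  then show ?case
    using lower_square[of "n + k"] assms(1) pow_two_power_Suc[of x k] lower_car[OF assms(2)] by simp
qed (use assms lower_car in auto)

text \<open>Squaring gains a step only from index 2 on, so the power is read as (a^2)^(2^(n-2)) with
  a^2 in \<Gamma>_2.\<close>

lemma a_pow_lower: "2 \<le> n \<Longrightarrow> a [^] ((2::nat) ^ (n - 1)) \<in> lower n"
proof -
  assume "2 \<le> n"
  then obtain m where n: "n = 2 + m" by (auto simp: le_iff_add)
  show "a [^] ((2::nat) ^ (n - 1)) \<in> lower n"
    using lower_pow[OF _ a_square_lower, of m] by (simp add: n nat_pow_pow del: nat_pow_Suc)
qed

lemma s_pow_lower: "2 \<le> n \<Longrightarrow> s [^] ((2::nat) ^ (n - 1)) \<in> lower n"
proof -
  assume "2 \<le> n"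
  then obtain m where n: "n = 2 + m" by (auto simp: le_iff_add)
  show "s [^] ((2::nat) ^ (n - 1)) \<in> lower n"
    using lower_pow[OF _ s_square_lower, of m] by (simp add: n nat_pow_pow del: nat_pow_Suc)
qed

lemma fibre_pow_lower:
  "2 \<le> i \<Longrightarrow> i \<le> n \<Longrightarrow> x \<in> fibre i \<Longrightarrow> x [^] ((2::nat) ^ (n - i)) \<in> lower n"
  using lower_pow[of i x "n - i"] fibre_lower by auto

lemma closure_term_lower: "2 \<le> n \<Longrightarrow> closure_term n \<subseteq> lower n"
  by (rule closure_term_least[OF lower_normal a_pow_lower s_pow_lower fibre_pow_lower])

end

section \<open>Trivial action on the fibre series modulo squares\<close>

context klein
begin

text \<open>The subgroup F_i^2 F_(i+1); the quotient of F_i by it is F_i / F_(i+1) reduced modulo 2.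
  The reduction is essential, since \<open>t\<close> acts on the class of \<open>a\<close> by
  inversion.\<close>

definition drift :: "nat \<Rightarrow> 'a set" where
  "drift i = pow_mod G (fibre i) (fibre (Suc i)) 2"

lemma fibre_commutator_self:
  "1 \<le> i \<Longrightarrow> x \<in> fibre i \<Longrightarrow> y \<in> fibre i \<Longrightarrow> commutator G x y \<in> fibre (Suc i)"
  by (rule fibre_commutator[OF _ _ subsetD[OF fibre_U]])

lemma drift_normal: "1 \<le> i \<Longrightarrow> drift i \<lhd> G"
  unfolding drift_def by (rule normal_pow_mod[OF fibre_normal fibre_normal fibre_commutator_self])

lemma square_drift:
  assumes x: "x \<in> fibre i" shows "x \<otimes> x \<in> drift i"
proof -
  have "x \<otimes> x = x [^] (2::nat) \<otimes> \<one>" using fibre_car[OF x] pow_two by simp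
  then show ?thesis
    unfolding drift_def pow_mod_def using x subgroup.one_closed[OF fibre_subgroup] by blast
qed

lemma fibre_Suc_drift: "fibre (Suc i) \<subseteq> drift i"
proof
  fix x assume x: "x \<in> fibre (Suc i)"
  have "x = \<one> [^] (2::nat) \<otimes> x" using fibre_car[OF x] by simp
  then show "x \<in> drift i"
    unfolding drift_def pow_mod_def using x subgroup.one_closed[OF fibre_subgroup] by blast
qed

lemma drift_least:
  assumes S: "subgroup S G" and "\<And>z. z \<in> fibre i \<Longrightarrow> z \<otimes> z \<in> S" and "fibre (Suc i) \<subseteq> S"
  shows "drift i \<subseteq> S"
proof
  fix x assume "x \<in> drift i"
  then obtain z w where "z \<in> fibre i" "w \<in> fibre (Suc i)" "x = z [^] (2::nat) \<otimes> w"
    unfolding drift_def pow_mod_def by blast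
  then show "x \<in> S"
    using assms subgroup.m_closed[OF S, of "z \<otimes> z" w] pow_two[OF fibre_car] by auto
qed

text \<open>On a square z^2 the commutator with h agrees with [z,h]^2 modulo
  \<open>drift (Suc i)\<close>, and [z,h] lies in F_(i+1). On F_(i+1) the commutator falls into
  F_(i+2).\<close>

lemma drift_commutator:
  assumes i: "1 \<le> i" and r: "r \<in> drift i" and h: "h \<in> U"
  shows "commutator G h r \<in> drift (Suc i)"
proof -
  have M: "drift (Suc i) \<lhd> G" using drift_normal by simp
  note sM = normal_imp_subgroup[OF M]
  have "drift i \<subseteq> {r \<in> carrier G. \<forall>h\<in>{h}. commutator G h r \<in> drift (Suc i)}"
  proof (rule drift_least[OF subgroup_commutator_in[OF M]])
    show "{h} \<subseteq> carrier G" using U_car h by blast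
  next
    fix z assume z: "z \<in> fibre i"
    have zc: "z \<in> carrier G" using fibre_car z by blast
    have zh: "commutator G z h \<in> fibre (Suc i)" using fibre_commutator[OF i z h] .
    have "z \<in> U" using z fibre_U by blast
    then have "commutator G (commutator G z h) z \<in> drift (Suc i)"
      using fibre_commutator[OF _ zh] fibre_Suc_drift by auto
    then have "commutator G (z \<otimes> z) h \<in> drift (Suc i)"
      using commutator_square_mod[OF M zc U_car[OF h]] square_drift[OF zh] by simp
    then show "z \<otimes> z \<in> {r \<in> carrier G. \<forall>h\<in>{h}. commutator G h r \<in> drift (Suc i)}"
      using commutator_swap_in[OF sM _ U_car[OF h], of "z \<otimes> z"] zc by simp
  next
    show "fibre (Suc i) \<subseteq> {r \<in> carrier G. \<forall>h\<in>{h}. commutator G h r \<in> drift (Suc i)}"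
    proof
      fix w assume w: "w \<in> fibre (Suc i)"
      have "commutator G w h \<in> drift (Suc i)"
        using fibre_commutator[OF _ w h] fibre_Suc_drift by auto
      then show "w \<in> {r \<in> carrier G. \<forall>h\<in>{h}. commutator G h r \<in> drift (Suc i)}"
        using commutator_swap_in[OF sM fibre_car[OF w] U_car[OF h]] fibre_car[OF w] by simp
    qed
  qed
  then show ?thesis using r by blast
qed

text \<open>The mirror image of the preceding lemma: now the squared element ranges over U and x is
  the deep one. The part of \<open>drift 1\<close> coming from F_2 is handled because a commutator
  with F_2 descends two steps at once.\<close>

lemma drift_1_commutator:
  assumes i: "1 \<le> i" and r: "r \<in> drift 1" and x: "x \<in> fibre i"
  shows "commutator G x r \<in> drift (Suc i)"
proof -
  have M: "drift (Suc i) \<lhd> G" using drift_normal by simp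
  note sM = normal_imp_subgroup[OF M]
  have xc: "x \<in> carrier G" using fibre_car x by blast
  have "drift 1 \<subseteq> {r \<in> carrier G. \<forall>x\<in>{x}. commutator G x r \<in> drift (Suc i)}"
  proof (rule drift_least[OF subgroup_commutator_in[OF M]])
    fix z assume "z \<in> fibre 1"
    then have z: "z \<in> U" by simp
    have zc: "z \<in> carrier G" using U_car[OF z] .
    have zx: "commutator G z x \<in> fibre (Suc i)"
      using commutator_swap_in[OF fibre_subgroup xc zc fibre_commutator[OF i x z]] .
    then have "commutator G (commutator G z x) z \<in> drift (Suc i)"
      using fibre_commutator[OF _ zx z] fibre_Suc_drift by auto
    then have "commutator G (z \<otimes> z) x \<in> drift (Suc i)"
      using commutator_square_mod[OF M zc xc] square_drift[OF zx] by simp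
    then show "z \<otimes> z \<in> {r \<in> carrier G. \<forall>x\<in>{x}. commutator G x r \<in> drift (Suc i)}"
      using commutator_swap_in[OF sM _ xc, of "z \<otimes> z"] zc by simp
  next
    show "fibre (Suc 1) \<subseteq> {r \<in> carrier G. \<forall>x\<in>{x}. commutator G x r \<in> drift (Suc i)}"
      using fibre_commutator_2[OF i x] fibre_Suc_drift fibre_car by (auto simp: numeral_2_eq_2)
  qed (use xc in simp)
  then show ?thesis using r by blast
qed

lemma commutator_drift_1:
  assumes "x \<in> U" "p \<in> carrier G"
  shows "commutator G x p \<in> drift 1"
proof -
  have M: "drift 1 \<lhd> G" using drift_normal by simp
  note sM = normal_imp_subgroup[OF M]
  have U: "a \<in> U" "b \<in> U" unfolding U_gen by (auto intro: generate.incl)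
  then have iU: "inv a \<in> U" using subgroup.m_inv_closed[OF normal_imp_subgroup[OF U_normal]] by simp
  have aa: "a \<otimes> a \<in> drift 1" using square_drift U by simp
  have UU: "commutator G x y \<in> drift 1" if "x \<in> U" "y \<in> U" for x y
    using fibre_commutator[of 1 x y] that fibre_Suc_drift[of 1] by auto
  have at: "commutator G a t \<in> drift 1"
    using a_pow_t[of 0] aa subgroup.m_inv_closed[OF sM] pow_two by simp
  have bt: "commutator G b t \<in> drift 1"
    unfolding b_t using subgroup.m_closed[OF sM UU[OF U(2) iU] aa] .
  have as: "commutator G a s \<in> drift 1" using a_pow_s[of 1] subgroup.one_closed[OF sM] by simp
  have "commutator G s b \<in> drift 1" using s_pow_b[OF M, of 0] aa pow_two by simp
  then have bs: "commutator G b s \<in> drift 1" using commutator_swap_in[OF sM] by simp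
  have gens: "commutator G x y \<in> drift 1" if "x \<in> {a, b}" "y \<in> {a, b, s, t}" for x y
    using that at bt as bs UU U by auto
  show ?thesis
    by (rule commutator_generate[OF M _ _ gens, of "{a, b}" "{a, b, s, t}"])
      (use assms[unfolded U_gen G_gen] in simp_all)
qed

text \<open>The complement generated by \<open>s\<close> and \<open>t\<close> acts trivially on \<open>U\<close> modulo squares and
  commutators, hence on every quotient \<open>fibre i / fibre (Suc i)\<close> modulo squares.\<close>
lemma commutator_drift:
  assumes "1 \<le> i" "x \<in> fibre i" "p \<in> carrier G"
  shows "commutator G x p \<in> drift i"
  using assms
proof (induction i arbitrary: x p rule: nat_induct_at_least)
  case base
  then show ?case using commutator_drift_1 by simp
next
  case (Suc i)
  let ?M = "drift (Suc i)"
  have M: "?M \<lhd> G" using drift_normal by simp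
  interpret q: group_hom G "G Mod ?M" "\<lambda>x. ?M #> x" using M by (rule quotient_hom)
  have com: "(?M #> u) \<otimes>\<^bsub>G Mod ?M\<^esub> (?M #> v) = (?M #> v) \<otimes>\<^bsub>G Mod ?M\<^esub> (?M #> u)"
    if "commutator G u v \<in> ?M" "u \<in> carrier G" "v \<in> carrier G" for u v
    using that by (simp add: commutator_in_normal_iff[OF M])
  have "fibre (Suc i) \<subseteq> central_mod ?M"
  proof (rule fibre_least[OF _ normal_imp_subgroup[OF central_mod_normal[OF M]]])
    fix x y assume x: "x \<in> fibre i" and y: "y \<in> U"
    have xU: "x \<in> U" using x fibre_U by blast
    have c: "x \<in> carrier G" "y \<in> carrier G" using U_car xU y by auto
    have xy: "commutator G x y \<in> fibre (Suc i)"
      using fibre_commutator[OF _ x y] Suc.hyps by simp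
    have "commutator G (commutator G x y) p \<in> ?M" if p: "p \<in> carrier G" for p
    proof -
      have r: "commutator G x p \<in> drift i" using Suc.IH[OF x p] .
      have r': "commutator G y p \<in> drift 1" using commutator_drift_1[OF y p] .
      have r'U: "commutator G y p \<in> U" using commutator_mod_self[OF U_normal y p] by simp
      have rU: "commutator G h (commutator G x p) \<in> ?M" if "h \<in> U" for h
        using drift_commutator[OF _ r that] Suc.hyps by simp
      \<comment> \<open>Modulo \<open>?M\<close>, [x,p] commutes with all of U, while [y,p] commutes
        with x and with [x,y]. These are the hypotheses of \<open>commutator_fixed\<close>.\<close>
      have "commutator G (commutator G x y) (commutator G y p) \<in> ?M"
        using fibre_commutator[OF _ xy r'U] fibre_Suc_drift by auto
      then show ?thesis
        using q.H.commutator_fixed[of "?M #> x" "?M #> y" "?M #> p"]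
          com[OF rU[OF xU]] com[OF rU[OF y]] com[OF rU[OF r'U]]
          com[OF drift_1_commutator[OF _ r' x]] com[of "commutator G x y" "commutator G y p"]
          Suc.hyps c p
        by (simp add: q.hom_commutator commutator_in_normal_iff[OF M])
    qed
    then show "commutator G x y \<in> central_mod ?M" using c by (simp add: central_mod_def)
  qed (use Suc.hyps in simp)
  then show ?case using Suc.prems by (auto simp: central_mod_def)
qed

end

section \<open>Approximating the lower central series by the closure\<close>

context klein
begin

lemma generate_join:
  "A \<subseteq> generate G (A \<union> B)" "B \<subseteq> generate G (A \<union> B)"
  by (auto intro: generate.incl)

definition approx :: "nat \<Rightarrow> 'a set" where
  "approx n = generate G (closure_term n \<union> lower (Suc n))"

lemma approx_normal: "approx n \<lhd> G"
  unfolding approx_def by (rule normal_join[OF closure_term_normal lower_normal])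

lemmas approx_subgroup = normal_imp_subgroup[OF approx_normal]

lemma closure_term_approx: "closure_term n \<subseteq> approx n"
  unfolding approx_def by (rule generate_join)

lemma lower_Suc_approx: "lower (Suc n) \<subseteq> approx n"
  unfolding approx_def by (rule generate_join)

lemma approx_least:
  assumes "subgroup S G" "closure_term n \<subseteq> S" "lower (Suc n) \<subseteq> S"
  shows "approx n \<subseteq> S"
  unfolding approx_def by (rule generate_subgroup_incl[OF _ assms(1)]) (use assms in blast)

text \<open>This makes squaring multiplicative on \<Gamma>_m modulo \<Gamma>_(m+2), two steps down
  rather than one.\<close>

lemma lower_commutator_self:
  assumes "2 \<le> m" "x \<in> lower m" "y \<in> lower m"
  shows "commutator G x y \<in> lower (Suc (Suc m))"
proof -
  have "y \<in> lower 2" using assms lower_antimono[of 2 m] by blast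
  then show ?thesis using lower_commutator_2[of m x y] assms by simp
qed

text \<open>Once the next powers of \<open>a\<close> and \<open>s\<close> are in M, the relations
  settle every commutator of the two given powers with a generator except that of the power of
  \<open>a\<close> with \<open>b\<close>. This one and the powers from the fibre remain as
  hypotheses.\<close>

lemma closure_term_central_mod:
  assumes m: "1 \<le> m" and M: "M \<lhd> G" and "a [^] ((2::nat) ^ m) \<in> M" "s [^] ((2::nat) ^ m) \<in> M"
    and ab: "commutator G (a [^] ((2::nat) ^ (m - 1))) b \<in> M"
    and x: "\<And>i x p. 2 \<le> i \<Longrightarrow> i \<le> m \<Longrightarrow> x \<in> fibre i \<Longrightarrow> p \<in> carrier G \<Longrightarrow>
      commutator G (x [^] ((2::nat) ^ (m - i))) p \<in> M"
  shows "closure_term m \<subseteq> central_mod M"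
proof -
  note sM = normal_imp_subgroup[OF M]
  obtain k where k: "m = Suc k" using m by (cases m) auto
  note one = subgroup.one_closed[OF sM] and inv = subgroup.m_inv_closed[OF sM]
  have "commutator G (a [^] ((2::nat) ^ k)) a = \<one>"
    using commutator_pow[of a a] by (simp add: commutator_self)
  moreover have "commutator G (s [^] ((2::nat) ^ k)) s = \<one>"
    using commutator_pow[of s s] by (simp add: commutator_self)
  ultimately show ?thesis
    using one inv[OF assms(3)] inv[OF assms(4)] ab s_pow_b[OF M] assms(3) unfolding k
    by (intro closure_term_least[OF central_mod_normal[OF M]] central_modI[OF M])
       (use x[unfolded k] fibre_car
        in \<open>auto simp: a_pow_t s_pow_t a_pow_s s_pow_a simp del: power_Suc\<close>)
qed

text \<open>Squaring doubles the exponent of each generator of M_m, which gives an element of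
  M_(m+1), and it takes \<Gamma>_(m+1) into \<Gamma>_(m+2). Being a homomorphism on \<Gamma>_m
  modulo the target, it need only be checked on these pieces.\<close>

lemma approx_square:
  assumes m: "2 \<le> m" and x: "x \<in> approx m"
  shows "x \<otimes> x \<in> approx (Suc m)"
proof -
  let ?W = "{y \<in> lower m. y [^] (2::nat) \<in> approx (Suc m)}"
  have W: "?W \<lhd> G"
    by (rule normal_pow_in[OF approx_normal lower_normal])
       (use lower_commutator_self[OF m] lower_Suc_approx in blast)
  have nxt: "x [^] ((2::nat) ^ Suc k) \<in> approx (Suc m) \<Longrightarrow>
      (x [^] ((2::nat) ^ k)) [^] (2::nat) \<in> approx (Suc m)" if "x \<in> carrier G" for x k
    using pow_two_power_Suc[OF that, of k] pow_two[of "x [^] ((2::nat) ^ k)"] that by simp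
  have mm: "Suc (m - 1) = m" using m by simp
  have inc: "y \<in> closure_term (Suc m) \<Longrightarrow> y \<in> approx (Suc m)" for y
    using closure_term_approx by blast
  have "approx m \<subseteq> ?W"
  proof (rule approx_least[OF normal_imp_subgroup[OF W]])
    show "closure_term m \<subseteq> ?W"
    proof (rule closure_term_least[OF W])
      show "a [^] ((2::nat) ^ (m - 1)) \<in> ?W"
        using a_pow_lower[OF m] nxt[of a "m - 1"] inc[OF a_pow_closure_term] mm by simp
      show "s [^] ((2::nat) ^ (m - 1)) \<in> ?W"
        using s_pow_lower[OF m] nxt[of s "m - 1"] inc[OF s_pow_closure_term] mm by simp
      show "x [^] ((2::nat) ^ (m - i)) \<in> ?W" if "2 \<le> i" "i \<le> m" "x \<in> fibre i" for x i
        using fibre_pow_lower[OF that] nxt[OF fibre_car[OF that(3)], of "m - i"]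
          inc[OF fibre_pow_closure_term[of i "Suc m" x]] that by (simp add: Suc_diff_le)
    qed
    show "lower (Suc m) \<subseteq> ?W"
    proof
      fix y assume y: "y \<in> lower (Suc m)"
      then have "y \<otimes> y \<in> lower (Suc (Suc m))" using lower_square m by simp
      then show "y \<in> ?W"
        using y lower_antimono[of m "Suc m"] lower_Suc_approx pow_two[OF lower_car[OF y]] by auto
    qed
  qed
  then have "x [^] (2::nat) \<in> approx (Suc m)" using x by blast
  moreover have "x \<in> carrier G" using subgroup.mem_carrier[OF approx_subgroup x] .
  ultimately show ?thesis using pow_two by simp
qed

text \<open>The successive quotients of \<open>lower\<close> have exponent two from the second one on, so
  the map \<open>u \<mapsto> u\<^sup>2\<close> induces homomorphisms between them which are compatible with commutators.\<close>
lemma lower_approx: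
  assumes "2 \<le> m" shows "lower m \<subseteq> approx m"
  using assms
proof (induction m rule: nat_induct_at_least)
  case base
  show ?case using lower_2_closure_term closure_term_approx by blast
next
  case (Suc m)
  let ?M = "approx (Suc m)"
  have M: "?M \<lhd> G" by (rule approx_normal)
  have inc: "y \<in> closure_term (Suc m) \<Longrightarrow> y \<in> ?M" for y using closure_term_approx by blast
  have inc': "y \<in> lower (Suc (Suc m)) \<Longrightarrow> y \<in> ?M" for y using lower_Suc_approx by blast
  \<comment> \<open>The generic case. [u,p] is in \<Gamma>_m, hence in \<open>approx m\<close> by
    induction, so its square is in \<open>?M\<close>. The bound 3 <= m puts u into \<Gamma>_2, so
    that [[u,p],u] descends two steps and [u^2,p] agrees with [u,p]^2.\<close>
  have square: "commutator G (u \<otimes> u) p \<in> ?M"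
    if u: "u \<in> lower (m - 1)" and p: "p \<in> carrier G" and m: "3 \<le> m" for u p
  proof -
    have up: "commutator G u p \<in> lower m" using lower_commutator[OF _ u p] m by simp
    have "2 \<le> m - 1" using m by linarith
    then have "u \<in> lower 2" using u lower_antimono by blast
    then have "commutator G (commutator G u p) u \<in> ?M"
      using lower_commutator_2[OF _ up] m inc' by simp
    moreover have "commutator G u p \<otimes> commutator G u p \<in> ?M"
      using approx_square[OF Suc.hyps] up Suc.IH by blast
    ultimately show ?thesis using commutator_square_mod[OF M lower_car[OF u] p] by simp
  qed
  \<comment> \<open>M_(m+1) contains the squares of F_m, as the powers with exponent 2^(m+1-m), and
    F_(m+1) itself.\<close>
  have dm: "drift m \<subseteq> ?M"
  proof (rule drift_least[OF normal_imp_subgroup[OF M]])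
    fix z assume z: "z \<in> fibre m"
    then have "z [^] ((2::nat) ^ (Suc m - m)) \<in> ?M"
      using inc[OF fibre_pow_closure_term[of m "Suc m"]] Suc.hyps by simp
    then show "z \<otimes> z \<in> ?M" using pow_two[OF fibre_car[OF z]] by simp
  next
    show "fibre (Suc m) \<subseteq> ?M" using fibre_closure_term[of "Suc m"] Suc.hyps inc by auto
  qed
  have "closure_term m \<subseteq> central_mod ?M"
  proof (rule closure_term_central_mod[OF _ M])
    show "1 \<le> m" using Suc.hyps by simp
    show "a [^] ((2::nat) ^ m) \<in> ?M" "s [^] ((2::nat) ^ m) \<in> ?M"
      using inc[OF a_pow_closure_term] inc[OF s_pow_closure_term] by simp_all
    show "commutator G (a [^] ((2::nat) ^ (m - 1))) b \<in> ?M"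
    proof (cases "m = 2")
      case True
      have U: "a \<in> U" "b \<in> U" unfolding U_gen by (auto intro: generate.incl)
      have ab: "commutator G a b \<in> fibre 2" using fibre_commutator[of 1 a b] U by (simp add: numeral_2_eq_2)
      then have "commutator G (commutator G a b) a \<in> fibre 3"
        using fibre_commutator[OF _ ab U(1)] by (simp add: numeral_3_eq_3 numeral_2_eq_2)
      then have "commutator G (commutator G a b) a \<in> ?M"
        using inc subsetD[OF fibre_closure_term[of 3]] True by simp
      moreover have "commutator G a b \<otimes> commutator G a b \<in> ?M"
        using dm square_drift[OF ab] True by blast
      ultimately have "commutator G (a \<otimes> a) b \<in> ?M" using commutator_square_mod[OF M] by simp
      then show ?thesis using True pow_two by simp
    next
      case False
      then have m: "3 \<le> m" using Suc.hyps by simp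
      then have e: "m - 1 = Suc (m - 1 - 1)" by simp
      show ?thesis
        using square[OF a_pow_lower gens_closed(2) m] m
        by (subst e, subst pow_two_power_Suc) simp_all
    qed
    show "commutator G (x [^] ((2::nat) ^ (m - i))) p \<in> ?M"
      if i: "2 \<le> i" "i \<le> m" and x: "x \<in> fibre i" and p: "p \<in> carrier G" for i x p
    proof (cases "i = m")
      \<comment> \<open>For i = m the exponent is 1 and no square can be split off. Here the
        triviality of the action on F_m modulo \<open>drift m\<close> takes over.\<close>
      case True
      then show ?thesis
        using subsetD[OF dm commutator_drift[of m x p]] i x p fibre_car[OF x] by simp
    next
      case False
      then have e: "m - i = Suc (m - 1 - i)" and m: "3 \<le> m" and im: "i \<le> m - 1" using i by auto
      show ?thesis
        using square[OF fibre_pow_lower[OF i(1) im x] p m] fibre_car[OF x]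
        by (subst e, subst pow_two_power_Suc) simp_all
    qed
  qed
  moreover have "lower (Suc m) \<subseteq> central_mod ?M"
    using lower_commutator[of "Suc m"] lower_car inc' by (auto simp: central_mod_def)
  ultimately have "approx m \<subseteq> central_mod ?M"
    by (rule approx_least[OF normal_imp_subgroup[OF central_mod_normal[OF M]]])
  then show ?case using lower_step[of m ?M] M Suc by auto
qed

section \<open>Termination by finite exponent\<close>

lemma pow_mod_normal: "1 \<le> j \<Longrightarrow> pow_mod G (fibre j) (fibre (Suc j)) k \<lhd> G"
  by (rule normal_pow_mod[OF fibre_normal fibre_normal fibre_commutator_self])

text \<open>Modulo F_2 the fibre is abelian and all powers from F_i with i >= 2 vanish. Only the
  powers of \<open>a\<close> and \<open>s\<close> remain, and the relations describe their
  commutators.\<close>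

lemma lower_fibre_2:
  assumes "2 \<le> k" shows "lower k \<subseteq> generate G (closure_term k \<union> fibre 2)"
  using assms
proof (induction k rule: nat_induct_at_least)
  case base
  show ?case using lower_2_closure_term generate_join(1) by (rule subset_trans)
next
  case (Suc k)
  let ?M = "generate G (closure_term (Suc k) \<union> fibre 2)"
  have M: "?M \<lhd> G" by (rule normal_join[OF closure_term_normal fibre_normal])
  have inc: "y \<in> closure_term (Suc k) \<Longrightarrow> y \<in> ?M" for y by (rule subsetD[OF generate_join(1)])
  have F: "fibre 2 \<subseteq> ?M" by (rule generate_join)
  have "fibre 2 \<subseteq> central_mod ?M" using F normal_central_mod[OF M] by blast
  moreover have "closure_term k \<subseteq> central_mod ?M"
  proof (rule closure_term_central_mod[OF _ M])
    show "a [^] ((2::nat) ^ k) \<in> ?M" "s [^] ((2::nat) ^ k) \<in> ?M"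
      using inc[OF a_pow_closure_term] inc[OF s_pow_closure_term] by simp_all
    have U: "a \<in> U" "b \<in> U" unfolding U_gen by (auto intro: generate.incl)
    then have "a [^] ((2::nat) ^ (k - 1)) \<in> U"
      using fibre_subgroup[of 1] by (metis fibre_1 One_nat_def int_pow_int subgroup_int_pow_closed)
    then show "commutator G (a [^] ((2::nat) ^ (k - 1))) b \<in> ?M"
      using F U fibre_commutator[of 1 _ b] by (auto simp: numeral_2_eq_2)
    show "commutator G (x [^] ((2::nat) ^ (k - i))) p \<in> ?M"
      if "2 \<le> i" "x \<in> fibre i" "p \<in> carrier G" for i x p
    proof -
      have "x [^] ((2::nat) ^ (k - i)) \<in> fibre i"
        using fibre_subgroup[of i] that(2) by (metis int_pow_int subgroup_int_pow_closed)
      then have "x [^] ((2::nat) ^ (k - i)) \<in> ?M" using F fibre_antimono[OF that(1)] by blast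
      then show ?thesis using commutator_mod_self(1)[OF M _ that(3)] by simp
    qed
  qed (use Suc.hyps in simp)
  ultimately have "generate G (closure_term k \<union> fibre 2) \<subseteq> central_mod ?M"
    by (intro generate_subgroup_incl[OF _ normal_imp_subgroup[OF central_mod_normal[OF M]]]) simp
  then show ?case using lower_step[of k ?M] M Suc by auto
qed

text \<open>F_j has exponent dividing 2^(n-j) modulo M_n F_(j+1). So replacing F_j by F_(j+1) costs
  n - j further steps in the lower central series.\<close>

lemma lower_fibre:
  assumes n: "2 \<le> n" and j: "2 \<le> j" "j \<le> n"
  shows "\<exists>m\<ge>n. lower m \<subseteq> generate G (closure_term n \<union> fibre j)"
  using j
proof (induction j rule: nat_induct_at_least)
  case base
  show ?case using lower_fibre_2[OF n] by blast
next
  case (Suc j)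
  then obtain m where m: "m \<ge> n" "lower m \<subseteq> generate G (closure_term n \<union> fibre j)" by auto
  \<comment> \<open>\<open>M k\<close> is M_n F_j^(2^k) F_(j+1). One more commutator doubles the
    exponent because the action on F_j is trivial modulo \<open>drift j\<close>. For k = 0 it
    contains M_n F_j, and for k = n - j the powers are absorbed by M_n.\<close>
  define M where "M k = generate G (closure_term n \<union> pow_mod G (fibre j) (fibre (Suc j)) (2 ^ k))" for k
  have j1: "1 \<le> j" using Suc.hyps by simp
  have M: "M k \<lhd> G" for k
    unfolding M_def by (rule normal_join[OF closure_term_normal pow_mod_normal[OF j1]])
  have "lower (m + k) \<subseteq> M k" for k
  proof (induction k)
    case 0
    have "fibre j \<subseteq> pow_mod G (fibre j) (fibre (Suc j)) (2 ^ 0)"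
    proof
      fix x assume x: "x \<in> fibre j"
      then have "x = x [^] ((2::nat) ^ 0) \<otimes> \<one>" using fibre_car by simp
      then show "x \<in> pow_mod G (fibre j) (fibre (Suc j)) (2 ^ 0)"
        unfolding pow_mod_def using x subgroup.one_closed[OF fibre_subgroup] by blast
    qed
    then have "closure_term n \<union> fibre j \<subseteq> M 0" unfolding M_def
      using generate_join[where A = "closure_term n" and B = "pow_mod G (fibre j) (fibre (Suc j)) (2 ^ 0)"]
      by blast
    then have "generate G (closure_term n \<union> fibre j) \<subseteq> M 0"
      by (rule generate_subgroup_incl[OF _ normal_imp_subgroup[OF M]])
    then show ?case using m(2) by simp
  next
    case (Suc k)
    have inc: "closure_term n \<subseteq> M (Suc k)"
      "pow_mod G (fibre j) (fibre (Suc j)) (2 ^ Suc k) \<subseteq> M (Suc k)"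
      unfolding M_def by (rule generate_join)+
    have "pow_mod G (fibre j) (fibre (Suc j)) (2 ^ k) \<subseteq> central_mod (M (Suc k))"
    proof
      fix x assume x: "x \<in> pow_mod G (fibre j) (fibre (Suc j)) (2 ^ k)"
      have "commutator G x p \<in> M (Suc k)" if p: "p \<in> carrier G" for p
        using commutator_pow_mod[OF fibre_normal fibre_normal fibre_commutator_self[OF j1] _ x p, of 2]
          commutator_drift[OF j1 _ p] inc(2) unfolding drift_def by auto
      then show "x \<in> central_mod (M (Suc k))"
        unfolding central_mod_def
        using subgroup.mem_carrier[OF normal_imp_subgroup[OF pow_mod_normal[OF j1]] x] by simp
    qed
    moreover have "closure_term n \<subseteq> central_mod (M (Suc k))"
      using inc(1) normal_central_mod[OF M] by blast
    ultimately have "M k \<subseteq> central_mod (M (Suc k))"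
      unfolding M_def[of k]
      by (intro generate_subgroup_incl[OF _ normal_imp_subgroup[OF central_mod_normal[OF M]]]) simp
    then show ?case using lower_step[of "m + k" "M (Suc k)"] M Suc m(1) n by auto
  qed
  then have 1: "lower (m + (n - j)) \<subseteq> M (n - j)" .
  let ?K = "generate G (closure_term n \<union> fibre (Suc j))"
  have K: "?K \<lhd> G" by (rule normal_join[OF closure_term_normal fibre_normal])
  have inc: "closure_term n \<subseteq> ?K" "fibre (Suc j) \<subseteq> ?K" by (rule generate_join)+
  have "M (n - j) \<subseteq> ?K"
    unfolding M_def
  proof (rule generate_subgroup_incl[OF _ normal_imp_subgroup[OF K]])
    have "x [^] ((2::nat) ^ (n - j)) \<otimes> w \<in> ?K" if "x \<in> fibre j" "w \<in> fibre (Suc j)" for x w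
      using subgroup.m_closed[OF normal_imp_subgroup[OF K]] fibre_pow_closure_term[OF _ _ that(1)]
        that inc Suc by (meson Suc_leD subsetD)
    then show "closure_term n \<union> pow_mod G (fibre j) (fibre (Suc j)) (2 ^ (n - j)) \<subseteq> ?K"
      using inc by (auto simp: pow_mod_def)
  qed
  then show ?case using 1 m(1) by (intro exI[of _ "m + (n - j)"]) auto
qed

lemma closure_term_antimono:
  assumes "2 \<le> n" "n \<le> m" shows "closure_term m \<subseteq> closure_term n"
proof (rule closure_term_least[OF closure_term_normal])
  have sub: "x [^] ((2::nat) ^ (k + j)) \<in> closure_term n"
    if "x [^] ((2::nat) ^ k) \<in> closure_term n" "x \<in> carrier G" for x j k
    using subgroup_int_pow_closed[OF closure_term_subgroup that(1), of "int (2 ^ j)"] that(2)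
    unfolding int_pow_int by (simp add: nat_pow_pow power_add)
  have e: "m - 1 = (n - 1) + (m - n)" using assms by simp
  show "a [^] ((2::nat) ^ (m - 1)) \<in> closure_term n"
    unfolding e by (rule sub[OF a_pow_closure_term]) simp
  show "s [^] ((2::nat) ^ (m - 1)) \<in> closure_term n"
    unfolding e by (rule sub[OF s_pow_closure_term]) simp
  fix x i assume i: "2 \<le> i" "i \<le> m" and x: "x \<in> fibre i"
  show "x [^] ((2::nat) ^ (m - i)) \<in> closure_term n"
  proof (cases "i \<le> n")
    case True
    then have e: "m - i = (n - i) + (m - n)" using assms by simp
    show ?thesis unfolding e by (rule sub[OF fibre_pow_closure_term]) (use i True x fibre_car in auto)
  next
    case False
    then have "x \<in> closure_term n"
      using x fibre_antimono[of n i] fibre_closure_term[OF assms(1)] by auto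
    then show ?thesis by (metis closure_term_subgroup int_pow_int subgroup_int_pow_closed)
  qed
qed

theorem lower_eq_closure_term:
  assumes n: "2 \<le> n" shows "lower n = closure_term n"
proof
  obtain m where m: "m \<ge> n" "lower m \<subseteq> generate G (closure_term n \<union> fibre n)"
    using lower_fibre[OF n n] by auto
  have "generate G (closure_term n \<union> fibre n) \<subseteq> closure_term n"
    by (rule generate_subgroup_incl[OF _ closure_term_subgroup]) (use fibre_closure_term[OF n] in blast)
  then have "lower m \<subseteq> closure_term n" using m(2) by blast
  \<comment> \<open>Descent by one: if \<Gamma>_(k+1) lies in M_n, so does \<open>approx k\<close>,
    since M_k lies in M_n; and \<open>approx k\<close> contains \<Gamma>_k.\<close>
  with m(1) show "lower n \<subseteq> closure_term n"
  proof (induction "m - n" arbitrary: m)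
    case (Suc d)
    then obtain k where k: "m = Suc k" "k \<ge> n" by (cases m) auto
    have "approx k \<subseteq> closure_term n"
      by (rule approx_least[OF closure_term_subgroup])
         (use closure_term_antimono[OF n k(2)] Suc.prems k in auto)
    then have "lower k \<subseteq> closure_term n" using lower_approx[of k] k n by auto
    then show ?case using Suc.hyps(1)[of k] Suc.hyps(2) k by simp
  qed simp
qed (rule closure_term_lower[OF n])

end

subsection \<open>The free group and the semidirect product\<close>

lemma inv_letter_inv_letter [simp]: "inv_letter (inv_letter l) = l"
  by (simp add: inv_letter_def)

lemma reduced_tl: "reduced (x # xs) \<Longrightarrow> reduced xs"
  by (cases xs) auto

lemma reduced_cons_red: "reduced w \<Longrightarrow> reduced (cons_red l w)"
  by (cases w) (auto intro: reduced_tl)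

lemma cons_red_inverse: "reduced w \<Longrightarrow> cons_red l (cons_red (inv_letter l) w) = w"
proof (cases w)
  case (Cons y ys)
  assume "reduced w"
  with Cons show ?thesis by (cases ys) auto
qed simp

text \<open>Van der Waerden's device: letters act on the reduced words by mutually inverse maps.
  Associativity of the free group then follows from \<open>act_reduce\<close>, with no confluence
  argument for cancellation.\<close>

abbreviation act :: "word \<Rightarrow> word \<Rightarrow> word" where
  "act \<equiv> foldr cons_red"

lemma reduced_act: "reduced w \<Longrightarrow> reduced (act u w)"
  by (induction u) (simp_all add: reduced_cons_red)

lemma act_cons_red: "reduced w \<Longrightarrow> act (cons_red l u) w = cons_red l (act u w)"
proof (induction u)
  case (Cons y u)
  then show ?case
    using cons_red_inverse[OF reduced_act[OF Cons.prems], of l u] by simp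
qed simp

lemma act_reduce: "reduced w \<Longrightarrow> act (reduce u) w = act u w"
proof (induction u)
  case (Cons l u)
  then show ?case using act_cons_red[of w l "reduce u"] by (simp add: reduce_def)
qed (simp add: reduce_def)

lemma reduced_reduce: "reduced (reduce u)"
  by (simp add: reduce_def reduced_act)

lemma reduce_reduced: "reduced w \<Longrightarrow> reduce w = w"
proof (induction w)
  case (Cons l w)
  then show ?case by (cases w) (auto simp: reduce_def dest: reduced_tl)
qed (simp add: reduce_def)

lemma reduce_append: "reduce (u @ v) = act u (reduce v)"
  by (simp add: reduce_def)

lemma act_inv_word: "reduced w \<Longrightarrow> act (inv_word u) (act u w) = w"
proof (induction u)
  case (Cons l u)
  then show ?case
    using cons_red_inverse[OF reduced_act[of w u], of "inv_letter l"] by (simp add: inv_word_def)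
qed (simp add: inv_word_def)

lemma carrier_H: "carrier H = {w. reduced w}" and one_H: "\<one>\<^bsub>H\<^esub> = []"
  by (simp_all add: H_def)

lemma mult_H: "reduced y \<Longrightarrow> x \<otimes>\<^bsub>H\<^esub> y = act x y"
  by (simp add: H_def reduce_append reduce_reduced)

lemma group_H: "group H"
proof (rule groupI)
  fix x y assume "x \<in> carrier H" "y \<in> carrier H"
  then show "x \<otimes>\<^bsub>H\<^esub> y \<in> carrier H" by (simp add: carrier_H mult_H reduced_act)
next
  fix x y z assume "x \<in> carrier H" "y \<in> carrier H" "z \<in> carrier H"
  then have r: "reduced x" "reduced y" "reduced z" by (simp_all add: carrier_H)
  have "x \<otimes>\<^bsub>H\<^esub> y \<otimes>\<^bsub>H\<^esub> z = act (reduce (x @ y)) z"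
    using r by (simp add: mult_H H_def reduce_append reduce_reduced)
  then show "x \<otimes>\<^bsub>H\<^esub> y \<otimes>\<^bsub>H\<^esub> z = x \<otimes>\<^bsub>H\<^esub> (y \<otimes>\<^bsub>H\<^esub> z)"
    using r by (simp add: act_reduce mult_H reduced_act)
next
  fix x assume x: "x \<in> carrier H"
  have "act (reduce (inv_word x)) x = []"
    using x act_inv_word[of "[]" x] act_reduce[of x "inv_word x"] reduce_reduced[of x]
    by (simp add: carrier_H reduce_def)
  then show "\<exists>y\<in>carrier H. y \<otimes>\<^bsub>H\<^esub> x = \<one>\<^bsub>H\<^esub>"
    using x reduced_reduce by (auto simp: carrier_H one_H mult_H)
qed (simp_all add: carrier_H one_H mult_H)

interpretation H: group H by (rule group_H)

lemma inv_H: "x \<in> carrier H \<Longrightarrow> inv\<^bsub>H\<^esub> x = reduce (inv_word x)"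
proof (rule H.inv_equality)
  assume x: "x \<in> carrier H"
  then show "reduce (inv_word x) \<otimes>\<^bsub>H\<^esub> x = \<one>\<^bsub>H\<^esub>"
    using act_inv_word[of "[]" x] act_reduce[of x "inv_word x"] reduce_reduced[of x]
    by (simp add: carrier_H one_H mult_H reduce_def)
qed (simp_all add: carrier_H reduced_reduce)

section \<open>The universal property of the free group\<close>

definition letter_val :: "('a, 'b) monoid_scheme \<Rightarrow> (gen \<Rightarrow> 'a) \<Rightarrow> letter \<Rightarrow> 'a" where
  "letter_val K f l = (if snd l then inv\<^bsub>K\<^esub> f (fst l) else f (fst l))"

definition word_val :: "('a, 'b) monoid_scheme \<Rightarrow> (gen \<Rightarrow> 'a) \<Rightarrow> word \<Rightarrow> 'a" where
  "word_val K f w = foldr (\<lambda>l k. letter_val K f l \<otimes>\<^bsub>K\<^esub> k) w \<one>\<^bsub>K\<^esub>"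

context group
begin

lemma letter_val_closed: "(\<And>x. f x \<in> carrier G) \<Longrightarrow> letter_val G f l \<in> carrier G"
  by (simp add: letter_val_def)

lemma word_val_closed: "(\<And>x. f x \<in> carrier G) \<Longrightarrow> word_val G f w \<in> carrier G"
  by (induction w) (simp_all add: word_val_def letter_val_closed)

lemma word_val_cons_red:
  assumes f: "\<And>x. f x \<in> carrier G"
  shows "word_val G f (cons_red l w) = letter_val G f l \<otimes> word_val G f w"
proof (cases w)
  case (Cons y ys)
  have "letter_val G f (inv_letter l) = inv (letter_val G f l)"
    using f by (simp add: letter_val_def inv_letter_def)
  then show ?thesis
    using Cons letter_val_closed[of f l, OF f] word_val_closed[of f ys, OF f]
    by (auto simp: word_val_def mult_inv_cancel_left)
qed (simp add: word_val_def)

lemma word_val_act: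
  assumes f: "\<And>x. f x \<in> carrier G"
  shows "word_val G f (act u w) = word_val G f u \<otimes> word_val G f w"
proof (induction u)
  case (Cons l u)
  then show ?case
    using letter_val_closed[of f l, OF f] word_val_closed[of f, OF f]
    by (simp add: word_val_cons_red[OF f]) (simp add: word_val_def m_assoc)
qed (use word_val_closed[of f w, OF f] in \<open>simp add: word_val_def\<close>)

lemma word_val_hom:
  assumes f: "\<And>x. f x \<in> carrier G"
  shows "word_val G f \<in> hom H G"
  by (rule homI) (use assms in \<open>simp_all add: word_val_closed mult_H carrier_H word_val_act\<close>)

lemma word_val_gen:
  assumes f: "\<And>x. f x \<in> carrier G"
  shows "word_val G f a2 = f A2" "word_val G f b2 = f B2"
  using f by (simp_all add: word_val_def letter_val_def a2_def b2_def)

end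

lemma gen_closed [simp]: "a2 \<in> carrier H" "b2 \<in> carrier H"
  by (simp_all add: carrier_H a2_def b2_def)

text \<open>Prepending a letter to a word that stays reduced is multiplication by that letter, so
  list induction becomes induction over the group.\<close>

lemma H_induct [consumes 1, case_names one a2 b2 inv_a2 inv_b2]:
  assumes "w \<in> carrier H" "P \<one>\<^bsub>H\<^esub>"
    and "\<And>w. w \<in> carrier H \<Longrightarrow> P w \<Longrightarrow> P (a2 \<otimes>\<^bsub>H\<^esub> w)"
    and "\<And>w. w \<in> carrier H \<Longrightarrow> P w \<Longrightarrow> P (b2 \<otimes>\<^bsub>H\<^esub> w)"
    and "\<And>w. w \<in> carrier H \<Longrightarrow> P w \<Longrightarrow> P (inv\<^bsub>H\<^esub> a2 \<otimes>\<^bsub>H\<^esub> w)"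
    and "\<And>w. w \<in> carrier H \<Longrightarrow> P w \<Longrightarrow> P (inv\<^bsub>H\<^esub> b2 \<otimes>\<^bsub>H\<^esub> w)"
  shows "P w"
  using assms(1)
proof (induction w)
  case Nil
  then show ?case using assms(2) by (simp add: one_H)
next
  case (Cons l w)
  then have r: "reduced w" using reduced_tl by (auto simp: carrier_H)
  then have w: "w \<in> carrier H" by (simp add: carrier_H)
  have inv: "inv\<^bsub>H\<^esub> a2 = [(A2, True)]" "inv\<^bsub>H\<^esub> b2 = [(B2, True)]"
    unfolding inv_H[OF gen_closed(1)] inv_H[OF gen_closed(2)]
    by (simp_all add: a2_def b2_def inv_word_def inv_letter_def reduce_def)
  have l: "l # w = [l] \<otimes>\<^bsub>H\<^esub> w"
    using Cons.prems r by (cases w) (simp_all add: mult_H carrier_H)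
  obtain x e where xe: "l = (x, e)" by (cases l)
  show ?case
    unfolding l using assms(3-6)[OF w Cons.IH[OF w]] inv
    by (cases x; cases e) (simp_all add: xe a2_def b2_def)
qed

lemma H_gen: "carrier H = generate H {a2, b2}"
proof
  show "carrier H \<subseteq> generate H {a2, b2}"
  proof
    fix w assume "w \<in> carrier H"
    then show "w \<in> generate H {a2, b2}"
      by (induction rule: H_induct) (auto intro!: generate.eng intro: generate.one generate.incl generate.inv)
  qed
qed (rule H.generate_incl, simp)

lemma hom_H_eqI:
  assumes f: "f \<in> hom H K" and g: "g \<in> hom H K" and K: "group K"
    and "f a2 = g a2" "f b2 = g b2" and w: "w \<in> carrier H"
  shows "f w = g w"
proof -
  interpret f: group_hom H K f using f K by (simp add: group_hom_def group_hom_axioms_def group_H)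
  interpret g: group_hom H K g using g K by (simp add: group_hom_def group_hom_axioms_def group_H)
  show ?thesis using w by (induction rule: H_induct) (simp_all add: assms(4,5))
qed

section \<open>The action on the free group\<close>

lemma subst_eq_word_val:
  assumes f: "\<And>x. f x \<in> carrier H"
  shows "subst f w = word_val H f w"
proof -
  let ?g = "\<lambda>(x, i). if i then inv_word (f x) else f x"
  have "reduce (concat (map ?g w)) = word_val H f w"
  proof (induction w)
    case (Cons l w)
    obtain x i where l: "l = (x, i)" by (cases l)
    have "reduced (word_val H f w)" using H.word_val_closed[of f w] f by (simp add: carrier_H)
    then show ?case
      using Cons.IH f[of x] l
      by (simp add: reduce_append word_val_def letter_val_def inv_H mult_H act_reduce)
  qed (simp add: reduce_def word_val_def one_H)
  then show ?thesis by (simp add: subst_def)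
qed

text \<open>Closed form of the m-th power of \<open>phi_alpha\<close>: a2 is fixed, so the factors
  a2^-2 accumulate in front of b2. Negative m gives the inverse automorphism explicitly.\<close>

definition twist :: "int \<Rightarrow> word \<Rightarrow> word" where
  "twist m = word_val H (\<lambda>x. case x of A2 \<Rightarrow> a2 | B2 \<Rightarrow> a2 [^]\<^bsub>H\<^esub> (- 2 * m) \<otimes>\<^bsub>H\<^esub> b2)"

lemma twist_hom: "twist m \<in> hom H H"
  unfolding twist_def by (rule H.word_val_hom) (simp split: gen.split)

lemma twist_group_hom: "group_hom H H (twist m)"
  using twist_hom by (simp add: group_hom_def group_hom_axioms_def group_H)

interpretation twist: group_hom H H "twist m" for m by (rule twist_group_hom)

lemma twist_gen [simp]:
  "twist m a2 = a2" "twist m b2 = a2 [^]\<^bsub>H\<^esub> (- 2 * m) \<otimes>\<^bsub>H\<^esub> b2"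
  unfolding twist_def by (subst H.word_val_gen; simp split: gen.split)+

lemma phi_alpha_eq: "phi_alpha = twist 1"
proof -
  have "a2 [^]\<^bsub>H\<^esub> (- 2 :: int) = inv\<^bsub>H\<^esub> a2 \<otimes>\<^bsub>H\<^esub> inv\<^bsub>H\<^esub> a2"
    using H.int_pow_mult[of a2 "-1" "-1"] by (simp add: H.int_pow_neg)
  then have "(\<lambda>x. case x of A2 \<Rightarrow> a2 | B2 \<Rightarrow> inv\<^bsub>H\<^esub> a2 \<otimes>\<^bsub>H\<^esub> inv\<^bsub>H\<^esub> a2 \<otimes>\<^bsub>H\<^esub> b2) =
      (\<lambda>x. case x of A2 \<Rightarrow> a2 | B2 \<Rightarrow> a2 [^]\<^bsub>H\<^esub> (- 2 * 1 :: int) \<otimes>\<^bsub>H\<^esub> b2)"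
    by (auto split: gen.split)
  moreover have "phi_alpha =
      word_val H (\<lambda>x. case x of A2 \<Rightarrow> a2 | B2 \<Rightarrow> inv\<^bsub>H\<^esub> a2 \<otimes>\<^bsub>H\<^esub> inv\<^bsub>H\<^esub> a2 \<otimes>\<^bsub>H\<^esub> b2)"
    unfolding phi_alpha_def by (intro ext subst_eq_word_val) (simp split: gen.split)
  ultimately show ?thesis by (simp only: twist_def)
qed

lemma phi_beta_eq: "phi_beta = word_val H (\<lambda>x. case x of A2 \<Rightarrow> inv\<^bsub>H\<^esub> a2 | B2 \<Rightarrow> a2 \<otimes>\<^bsub>H\<^esub> b2 \<otimes>\<^bsub>H\<^esub> a2)"
  unfolding phi_beta_def by (intro ext subst_eq_word_val) (simp split: gen.split)

lemma phi_beta_hom: "phi_beta \<in> hom H H"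
  unfolding phi_beta_eq by (rule H.word_val_hom) (simp split: gen.split)

interpretation phi_beta: group_hom H H phi_beta
  using phi_beta_hom by (simp add: group_hom_def group_hom_axioms_def group_H)

lemma phi_beta_gen [simp]:
  "phi_beta a2 = inv\<^bsub>H\<^esub> a2" "phi_beta b2 = a2 \<otimes>\<^bsub>H\<^esub> b2 \<otimes>\<^bsub>H\<^esub> a2"
  unfolding phi_beta_eq by (subst H.word_val_gen; simp split: gen.split)+

lemma hom_compose_mem: "f \<in> hom H H \<Longrightarrow> g \<in> hom H H \<Longrightarrow> (\<lambda>w. f (g w)) \<in> hom H H"
  by (auto simp: hom_def)

lemma twist_twist:
  assumes "w \<in> carrier H" shows "twist m (twist k w) = twist (m + k) w"
proof (rule hom_H_eqI[OF hom_compose_mem[OF twist_hom twist_hom] twist_hom group_H _ _ assms])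
  have "a2 [^]\<^bsub>H\<^esub> (- 2 * (m + k)) = a2 [^]\<^bsub>H\<^esub> (- 2 * k) \<otimes>\<^bsub>H\<^esub> a2 [^]\<^bsub>H\<^esub> (- 2 * m)"
    by (simp add: H.int_pow_mult[symmetric] algebra_simps)
  then show "twist m (twist k b2) = twist (m + k) b2"
    by (simp add: twist.hom_int_pow H.m_assoc)
qed simp

lemma twist_0: "w \<in> carrier H \<Longrightarrow> twist 0 w = w"
  by (rule hom_H_eqI[OF twist_hom _ group_H, of "\<lambda>w. w"]) (simp_all add: hom_def)

lemma phi_beta_phi_beta:
  assumes "w \<in> carrier H" shows "phi_beta (phi_beta w) = w"
  by (rule hom_H_eqI[OF hom_compose_mem[OF phi_beta_hom phi_beta_hom] _ group_H _ _ assms])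
     (simp_all add: hom_def H.word_simps)

text \<open>The relation \<beta>\<alpha>^m = \<alpha>^(-m)\<beta> on the level of automorphisms, on
  which multiplicativity of \<open>phi\<close> rests. On b2 both sides are a2^(2m+1) b2 a2.\<close>

lemma phi_beta_twist:
  assumes "w \<in> carrier H" shows "phi_beta (twist m w) = twist (- m) (phi_beta w)"
proof (rule hom_H_eqI[OF hom_compose_mem[OF phi_beta_hom twist_hom]
      hom_compose_mem[OF twist_hom phi_beta_hom] group_H _ _ assms])
  have "inv\<^bsub>H\<^esub> a2 [^]\<^bsub>H\<^esub> (- 2 * m) \<otimes>\<^bsub>H\<^esub> a2 = a2 \<otimes>\<^bsub>H\<^esub> a2 [^]\<^bsub>H\<^esub> (2 * m)"
    using H.int_pow_mult[of a2 "2 * m" 1] H.int_pow_mult[of a2 1 "2 * m"]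
      H.int_pow_neg[of a2 "2 * m"]
    by (simp add: H.int_pow_inv H.int_pow_neg add.commute)
  then show "phi_beta (twist m b2) = twist (- m) (phi_beta b2)"
    by (simp add: phi_beta.hom_int_pow H.m_assoc[symmetric])
qed simp

text \<open>An additive family F with F 1 = f consists of the powers of f. For negative exponents, F
  (-1) shows f injective on the carrier and identifies \<open>inv_into\<close> there.\<close>

lemma zpow_fun_eq:
  assumes F: "\<And>m w. w \<in> carrier H \<Longrightarrow> F m w \<in> carrier H"
    and add: "\<And>m k w. w \<in> carrier H \<Longrightarrow> F m (F k w) = F (m + k) w"
    and zero: "\<And>w. w \<in> carrier H \<Longrightarrow> F 0 w = w"
    and f: "\<And>w. w \<in> carrier H \<Longrightarrow> f w = F 1 w"
    and w: "w \<in> carrier H"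
  shows "zpow_fun f (m :: int) w = F m w"
proof -
  have pow: "(g ^^ n) w = F (int n * k) w"
    if g: "\<And>w. w \<in> carrier H \<Longrightarrow> g w = F k w" for g n k
    by (induction n) (simp_all add: zero w g F add algebra_simps)
  have inj: "inj_on f (carrier H)"
    by (rule inj_on_inverseI[of _ "F (- 1)"]) (simp add: f add zero)
  have inv: "inv_into (carrier H) f w = F (- 1) w" if "w \<in> carrier H" for w
    by (rule inv_into_f_eq[OF inj]) (use that in \<open>simp_all add: F f add zero\<close>)
  show ?thesis
    using pow[of f 1 "nat m"] pow[of "inv_into (carrier H) f" "- 1" "nat (- m)"] f inv
    by (simp add: zpow_fun_def)
qed

text \<open>\<open>phi_beta\<close> is an involution, so its k-th power depends only on the parity
  of k.\<close>

definition flip :: "int \<Rightarrow> word \<Rightarrow> word" where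
  "flip k w = (if even k then w else phi_beta w)"

lemma flip_hom: "flip k \<in> hom H H"
  unfolding flip_def by (cases "even k") (simp_all add: phi_beta_hom, simp add: hom_def)

lemma flip_flip: "w \<in> carrier H \<Longrightarrow> flip m (flip k w) = flip (m + k) w"
  by (simp add: flip_def phi_beta_phi_beta)

lemma phi_eq:
  assumes "w \<in> carrier H" shows "phi (m, k) w = twist m (flip k w)"
proof -
  have "zpow_fun phi_beta k w = flip k w"
    by (rule zpow_fun_eq[of flip]) (use assms flip_flip in \<open>simp_all add: flip_def\<close>)
  moreover have "zpow_fun phi_alpha m (flip k w) = twist m (flip k w)"
    by (rule zpow_fun_eq[of twist])
      (use assms in \<open>simp_all add: twist_twist twist_0 phi_alpha_eq flip_def\<close>)
  ultimately show ?thesis by (simp add: phi_def)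
qed

lemma phi_hom: "phi g \<in> hom H H"
proof -
  obtain m k where g: "g = (m, k)" by (cases g)
  show ?thesis
    using hom_compose_mem[OF twist_hom flip_hom, of m k] H.m_closed
    unfolding g by (auto simp: hom_def phi_eq)
qed

interpretation phi: group_hom H H "phi g" for g
  using phi_hom by (simp add: group_hom_def group_hom_axioms_def group_H)

lemma group_G: "group G"
proof (rule groupI)
  fix x assume "x \<in> carrier G"
  have "(if even (snd x) then - fst x else fst x, - snd x) \<otimes>\<^bsub>G\<^esub> x = \<one>\<^bsub>G\<^esub>"
    by (simp add: G_def G_mult_def)
  then show "\<exists>y\<in>carrier G. y \<otimes>\<^bsub>G\<^esub> x = \<one>\<^bsub>G\<^esub>" by (intro bexI) (simp_all add: G_def)
qed (auto simp: G_def G_mult_def)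

interpretation G: group G by (rule group_G)

lemma G_simps [simp]:
  "g \<in> carrier G" "\<one>\<^bsub>G\<^esub> = (0, 0)"
  "(m, k) \<otimes>\<^bsub>G\<^esub> (m', k') = (m + (if even k then m' else - m'), k + k')"
  by (simp_all add: G_def G_mult_def)

lemma phi_mult:
  assumes "w \<in> carrier H" shows "phi (g \<otimes>\<^bsub>G\<^esub> g') w = phi g (phi g' w)"
proof -
  obtain m k m' k' where g: "g = (m, k)" "g' = (m', k')" by (cases g, cases g')
  have "flip k (twist m' v) = twist (if even k then m' else - m') (flip k v)" if "v \<in> carrier H" for v
    using that by (simp add: flip_def phi_beta_twist)
  moreover have "flip k' w \<in> carrier H" using assms by (simp add: flip_def)
  ultimately show ?thesis
    using assms by (simp add: g phi_eq twist_twist flip_flip[symmetric] flip_def phi_beta_phi_beta)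
qed

lemma phi_one: "w \<in> carrier H \<Longrightarrow> phi (0, 0) w = w"
  by (simp add: phi_eq flip_def twist_0)

section \<open>The semidirect product as a Klein bottle extension\<close>

lemma carrier_P2K: "carrier P2K = carrier H \<times> UNIV"
  and one_P2K: "\<one>\<^bsub>P2K\<^esub> = (\<one>\<^bsub>H\<^esub>, (0, 0))"
  and mult_P2K: "(h, g) \<otimes>\<^bsub>P2K\<^esub> (h', g') = (h \<otimes>\<^bsub>H\<^esub> phi g h', g \<otimes>\<^bsub>G\<^esub> g')"
  by (auto simp: P2K_def G_def)

lemma P2K_left_inverse:
  "h \<in> carrier H \<Longrightarrow> (phi (inv\<^bsub>G\<^esub> g) (inv\<^bsub>H\<^esub> h), inv\<^bsub>G\<^esub> g) \<otimes>\<^bsub>P2K\<^esub> (h, g) = \<one>\<^bsub>P2K\<^esub>"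
  using G.l_inv[of g] phi.hom_mult[of "inv\<^bsub>H\<^esub> h" h "inv\<^bsub>G\<^esub> g"]
  by (simp add: mult_P2K one_P2K)

lemma group_P2K: "group P2K"
proof (rule groupI)
  fix x y z assume "x \<in> carrier P2K" "y \<in> carrier P2K" "z \<in> carrier P2K"
  then show "x \<otimes>\<^bsub>P2K\<^esub> y \<otimes>\<^bsub>P2K\<^esub> z = x \<otimes>\<^bsub>P2K\<^esub> (y \<otimes>\<^bsub>P2K\<^esub> z)"
    by (cases x, cases y, cases z)
       (simp add: mult_P2K carrier_P2K phi_mult H.m_assoc G.m_assoc del: G_simps(3))
next
  fix x assume "x \<in> carrier P2K"
  then obtain h g where x: "x = (h, g)" "h \<in> carrier H" by (cases x) (auto simp: carrier_P2K)
  have "(phi (inv\<^bsub>G\<^esub> g) (inv\<^bsub>H\<^esub> h), inv\<^bsub>G\<^esub> g) \<in> carrier P2K" using x by (simp add: carrier_P2K)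
  then show "\<exists>y\<in>carrier P2K. y \<otimes>\<^bsub>P2K\<^esub> x = \<one>\<^bsub>P2K\<^esub>"
    using P2K_left_inverse x by blast
qed (auto simp: carrier_P2K one_P2K mult_P2K phi_one)

interpretation P2K: group P2K by (rule group_P2K)

lemma inv_P2K: "h \<in> carrier H \<Longrightarrow> inv\<^bsub>P2K\<^esub> (h, g) = (phi (inv\<^bsub>G\<^esub> g) (inv\<^bsub>H\<^esub> h), inv\<^bsub>G\<^esub> g)"
  by (rule P2K.inv_equality[OF P2K_left_inverse]) (simp_all add: carrier_P2K)

text \<open>Serves twice: it identifies the series of H with that of its copy in the product, and it
  shows that the action preserves each \<open>Gamma H i\<close>.\<close>

lemma (in group_hom) image_lcs:
  assumes U: "U \<lhd> G"
  shows "h ` lcs G U n = lcs H (h ` U) n"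
proof (induction n rule: induct_nat_012)
  case (ge2 n)
  have c: "x \<in> carrier G" "y \<in> carrier G" if "x \<in> lcs G U (Suc n)" "y \<in> U" for x y
    using that G.lcs_mem_carrier[OF U] subgroup.mem_carrier[OF normal_imp_subgroup[OF U]] by blast+
  let ?A = "{commutator G x y |x y. x \<in> lcs G U (Suc n) \<and> y \<in> U}"
  have "{commutator H x y |x y. x \<in> h ` lcs G U (Suc n) \<and> y \<in> h ` U} = h ` ?A"
    using c by (auto simp: hom_commutator image_iff) (metis hom_commutator)+
  moreover have "?A \<subseteq> carrier G" using c by auto
  ultimately show ?case unfolding lcs.simps ge2(2)[symmetric] using generate_img[of ?A] by simp
qed simp_all

definition emb :: "word \<Rightarrow> word \<times> int \<times> int" where "emb h = (h, (0, 0))"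
definition lift_G :: "int \<times> int \<Rightarrow> word \<times> int \<times> int" where "lift_G g = (\<one>\<^bsub>H\<^esub>, g)"

lemma emb_hom: "emb \<in> hom H P2K"
  by (rule homI) (simp_all add: emb_def carrier_P2K mult_P2K phi_one)

lemma lift_G_hom: "lift_G \<in> hom G P2K"
  by (rule homI) (simp_all add: lift_G_def carrier_P2K mult_P2K del: G_simps(3))

interpretation emb: group_hom H P2K emb
  using emb_hom by (simp add: group_hom_def group_hom_axioms_def group_H group_P2K)

interpretation lift_G: group_hom G P2K lift_G
  using lift_G_hom by (simp add: group_hom_def group_hom_axioms_def group_G group_P2K)

lemma emb_lift_G: "h \<in> carrier H \<Longrightarrow> emb h \<otimes>\<^bsub>P2K\<^esub> lift_G g = (h, g)"
  by (simp add: emb_def lift_G_def mult_P2K)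

lemma snd_hom: "group_hom P2K G snd"
proof -
  have "snd \<in> hom P2K G" by (rule homI) (auto simp: mult_P2K)
  then show ?thesis by (simp add: group_hom_def group_hom_axioms_def group_G group_P2K)
qed

lemma G_pow: "alpha [^]\<^bsub>G\<^esub> (m::int) = (m, 0)" "beta [^]\<^bsub>G\<^esub> (m::int) = (0, m)"
proof -
  have nat: "alpha [^]\<^bsub>G\<^esub> (n::nat) = (int n, 0)" "beta [^]\<^bsub>G\<^esub> n = (0, int n)" for n
    by (induction n) (simp_all add: alpha_def beta_def)
  have inv: "inv\<^bsub>G\<^esub> (k, 0) = (- k, 0)" "inv\<^bsub>G\<^esub> (0, k) = (0, - k)" for k
    by (rule G.inv_equality; simp)+
  show "alpha [^]\<^bsub>G\<^esub> m = (m, 0)" "beta [^]\<^bsub>G\<^esub> m = (0, m)"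
    by (simp_all add: int_pow_def2 nat inv)
qed

lemma P2K_klein: "klein P2K (emb ` carrier H) (emb a2) (emb b2) (lift_G alpha) (lift_G beta)"
proof (intro klein.intro[OF group_P2K] klein_axioms.intro)
  interpret snd: group_hom P2K G snd by (rule snd_hom)
  have "kernel P2K G snd = emb ` carrier H"
    by (auto simp: kernel_def carrier_P2K emb_def)
  then show "emb ` carrier H \<lhd> P2K" using snd.normal_kernel by simp
  show gen: "emb ` carrier H = generate P2K {emb a2, emb b2}"
    using emb.generate_img[of "{a2, b2}"] H_gen[symmetric] by simp
  have car: "{emb a2, emb b2, lift_G alpha, lift_G beta} \<subseteq> carrier P2K" by simp
  note sub = P2K.generate_is_subgroup[OF car]
  show "carrier P2K = generate P2K {emb a2, emb b2, lift_G alpha, lift_G beta}"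
  proof
    show "carrier P2K \<subseteq> generate P2K {emb a2, emb b2, lift_G alpha, lift_G beta}"
    proof
      fix x assume "x \<in> carrier P2K"
      then obtain h m k where x: "x = (h, (m, k))" "h \<in> carrier H" by (auto simp: carrier_P2K)
      have "emb h \<in> generate P2K {emb a2, emb b2}" using gen x by blast
      then have h: "emb h \<in> generate P2K {emb a2, emb b2, lift_G alpha, lift_G beta}"
        using P2K.mono_generate[of "{emb a2, emb b2}" "{emb a2, emb b2, lift_G alpha, lift_G beta}"] by blast
      have "lift_G (m, k) = lift_G alpha [^]\<^bsub>P2K\<^esub> m \<otimes>\<^bsub>P2K\<^esub> lift_G beta [^]\<^bsub>P2K\<^esub> k"
        by (simp add: lift_G.hom_int_pow[symmetric] G_pow lift_G.hom_mult[symmetric] del: lift_G.hom_mult)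
      moreover have "lift_G alpha \<in> generate P2K {emb a2, emb b2, lift_G alpha, lift_G beta}"
        "lift_G beta \<in> generate P2K {emb a2, emb b2, lift_G alpha, lift_G beta}"
        by (auto intro: generate.incl)
      ultimately have "lift_G (m, k) \<in> generate P2K {emb a2, emb b2, lift_G alpha, lift_G beta}"
        using P2K.subgroup_int_pow_closed[OF sub] subgroup.m_closed[OF sub] by simp
      then show "x \<in> generate P2K {emb a2, emb b2, lift_G alpha, lift_G beta}"
        using h subgroup.m_closed[OF sub] x emb_lift_G by metis
    qed
  qed (rule P2K.generate_incl[OF car])
  have phi: "phi alpha a2 = a2" "phi alpha b2 = inv\<^bsub>H\<^esub> a2 \<otimes>\<^bsub>H\<^esub> inv\<^bsub>H\<^esub> a2 \<otimes>\<^bsub>H\<^esub> b2"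
    "phi beta a2 = inv\<^bsub>H\<^esub> a2" "phi beta b2 = a2 \<otimes>\<^bsub>H\<^esub> b2 \<otimes>\<^bsub>H\<^esub> a2"
    using H.int_pow_mult[of a2 "-1" "-1"]
    by (simp_all add: alpha_def beta_def phi_eq flip_def twist_0 H.int_pow_neg)
  have swap: "lift_G g \<otimes>\<^bsub>P2K\<^esub> emb h = emb (phi g h) \<otimes>\<^bsub>P2K\<^esub> lift_G g" if "h \<in> carrier H" for g h
    using that by (cases g) (simp add: emb_def lift_G_def mult_P2K)
  show "lift_G alpha \<otimes>\<^bsub>P2K\<^esub> emb a2 = emb a2 \<otimes>\<^bsub>P2K\<^esub> lift_G alpha"
    "lift_G alpha \<otimes>\<^bsub>P2K\<^esub> emb b2 =
      inv\<^bsub>P2K\<^esub> emb a2 \<otimes>\<^bsub>P2K\<^esub> inv\<^bsub>P2K\<^esub> emb a2 \<otimes>\<^bsub>P2K\<^esub> emb b2 \<otimes>\<^bsub>P2K\<^esub> lift_G alpha"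
    "lift_G beta \<otimes>\<^bsub>P2K\<^esub> emb a2 = inv\<^bsub>P2K\<^esub> emb a2 \<otimes>\<^bsub>P2K\<^esub> lift_G beta"
    "lift_G beta \<otimes>\<^bsub>P2K\<^esub> emb b2 = emb a2 \<otimes>\<^bsub>P2K\<^esub> emb b2 \<otimes>\<^bsub>P2K\<^esub> emb a2 \<otimes>\<^bsub>P2K\<^esub> lift_G beta"
    by (simp_all add: swap phi)
  have "beta \<otimes>\<^bsub>G\<^esub> alpha = inv\<^bsub>G\<^esub> alpha \<otimes>\<^bsub>G\<^esub> beta"
    using G_pow(1)[of "-1"] by (simp add: G.int_pow_neg alpha_def beta_def)
  then show "lift_G beta \<otimes>\<^bsub>P2K\<^esub> lift_G alpha = inv\<^bsub>P2K\<^esub> lift_G alpha \<otimes>\<^bsub>P2K\<^esub> lift_G beta"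
    by (metis G.inv_closed G_simps(1) lift_G.hom_inv lift_G.hom_mult)
qed simp_all

interpretation K: klein P2K "emb ` carrier H" "emb a2" "emb b2" "lift_G alpha" "lift_G beta"
  by (rule P2K_klein)

lemma fibre_eq: "K.fibre n = emb ` Gamma H n"
  by (simp add: K.fibre_def Gamma_eq_lcs emb.image_lcs[OF H.normal_self])

lemma Gamma_H_carrier: "x \<in> Gamma H i \<Longrightarrow> x \<in> carrier H"
  using H.lcs_mem_carrier[OF H.normal_self] by (simp add: Gamma_eq_lcs)

section \<open>The closure as a semidirect product\<close>

definition N_gens :: "nat \<Rightarrow> word set" where
  "N_gens n = {a2 [^]\<^bsub>H\<^esub> (2::nat) ^ (n - 1)} \<union>
      {x [^]\<^bsub>H\<^esub> (2::nat) ^ (n - i) | x i. 2 \<le> i \<and> i \<le> n \<and> x \<in> Gamma H i}"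

lemma N_eq: "N n = normal_closure H (N_gens n)"
  by (simp add: N_def N_gens_def)

lemma N_gens_carrier: "N_gens n \<subseteq> carrier H"
  using Gamma_H_carrier by (auto simp: N_gens_def)

lemma N_normal: "N n \<lhd> H"
  unfolding N_eq by (rule H.normal_closure_normal[OF N_gens_carrier])

lemmas N_subgroup = normal_imp_subgroup[OF N_normal]
lemmas N_carrier = subgroup.mem_carrier[OF N_subgroup]

lemma N_incl: "x \<in> N_gens n \<Longrightarrow> x \<in> N n"
  unfolding N_eq by (rule H.normal_closure_incl[OF N_gens_carrier])

lemma Gamma_pow_N: "2 \<le> i \<Longrightarrow> i \<le> n \<Longrightarrow> x \<in> Gamma H i \<Longrightarrow> x [^]\<^bsub>H\<^esub> (2::nat) ^ (n - i) \<in> N n"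
  by (rule N_incl) (auto simp: N_gens_def)

lemma a2_pow_N: "2 ^ (n - 1) dvd m \<Longrightarrow> a2 [^]\<^bsub>H\<^esub> (m::int) \<in> N n"
proof -
  assume "2 ^ (n - 1) dvd m"
  then obtain k where "m = int (2 ^ (n - 1)) * k" by (auto simp: dvd_def)
  moreover have "a2 [^]\<^bsub>H\<^esub> int (2 ^ (n - 1)) \<in> N n"
    unfolding int_pow_int by (rule N_incl) (simp add: N_gens_def)
  ultimately show ?thesis
    using H.subgroup_int_pow_closed[OF N_subgroup] H.int_pow_pow[of a2] by (metis gen_closed(1))
qed

lemma phi_Gamma: "x \<in> Gamma H i \<Longrightarrow> phi g x \<in> Gamma H i"
proof -
  assume "x \<in> Gamma H i"
  then have "phi g x \<in> lcs H (phi g ` carrier H) i"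
    using phi.image_lcs[OF H.normal_self, of g i] by (auto simp: Gamma_eq_lcs)
  moreover have "phi g ` carrier H \<subseteq> carrier H" by auto
  ultimately show ?thesis using H.lcs_mono[OF _ H.normal_self] by (auto simp: Gamma_eq_lcs)
qed

text \<open>The action sends a2 to itself or its inverse and maps each \<open>Gamma H i\<close> into
  itself, so the normal generators stay inside \<open>N n\<close>.\<close>

lemma phi_N:
  assumes "w \<in> N n" shows "phi g w \<in> N n"
proof -
  have s: "subgroup {w \<in> carrier H. phi g w \<in> N n} H"
    by (rule H.subgroup_vimage[OF phi.group_hom_axioms N_subgroup])
  have "{w \<in> carrier H. phi g w \<in> N n} \<lhd> H"
    by (rule H.normal_invI[OF s]) (use normal.inv_op_closed2[OF N_normal] in simp)
  moreover have "N_gens n \<subseteq> {w \<in> carrier H. phi g w \<in> N n}"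
  proof
    fix y assume y: "y \<in> N_gens n"
    obtain m k where g: "g = (m, k)" by (cases g)
    have a: "phi g a2 = (if even k then a2 else inv\<^bsub>H\<^esub> a2)"
      by (simp add: g phi_eq flip_def)
    have "phi g (a2 [^]\<^bsub>H\<^esub> (2::nat) ^ (n - 1)) \<in> N n"
      using a2_pow_N[of n "int (2 ^ (n - 1))"] subgroup.m_inv_closed[OF N_subgroup[of n]]
      unfolding int_pow_int by (simp add: phi.hom_nat_pow a H.nat_pow_inv)
    moreover have "phi g (x [^]\<^bsub>H\<^esub> (2::nat) ^ (n - i)) \<in> N n"
      if "2 \<le> i" "i \<le> n" "x \<in> Gamma H i" for x i
      using Gamma_pow_N[OF that(1,2) phi_Gamma[OF that(3)]] Gamma_H_carrier[OF that(3)]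
      by (simp add: phi.hom_nat_pow)
    ultimately show "y \<in> {w \<in> carrier H. phi g w \<in> N n}"
      using y subsetD[OF N_gens_carrier y] by (auto simp: N_gens_def)
  qed
  ultimately have "N n \<subseteq> {w \<in> carrier H. phi g w \<in> N n}"
    unfolding N_eq[of n] using H.normal_closure_least by (simp add: N_eq)
  then show ?thesis using assms by blast
qed

text \<open>\<open>twist m\<close> changes b2 only by a2^(-2m), which lies in \<open>N n\<close>, so
  it induces the identity on the quotient. The product in the statement is the H-component that
  arises when \<alpha>^m is conjugated by w.\<close>

lemma twist_mod_N:
  assumes "2 ^ (n - 1) dvd m" and w: "w \<in> carrier H"
  shows "w \<otimes>\<^bsub>H\<^esub> inv\<^bsub>H\<^esub> twist m w \<in> N n"
proof -
  interpret q: group_hom H "H Mod N n" "\<lambda>x. N n #>\<^bsub>H\<^esub> x" by (rule H.quotient_hom[OF N_normal])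
  have t: "twist m \<in> hom H H" by (rule twist_hom)
  have hom: "(\<lambda>w. N n #>\<^bsub>H\<^esub> twist m w) \<in> hom H (H Mod N n)"
    by (rule homI) (use t in \<open>simp_all add: hom_def Pi_iff\<close>)
  have "(2::int) ^ (n - 1) dvd - 2 * m" using assms(1) by (rule dvd_mult)
  then have "N n #>\<^bsub>H\<^esub> (a2 [^]\<^bsub>H\<^esub> (- 2 * m)) = \<one>\<^bsub>H Mod N n\<^esub>"
    using a2_pow_N[of n "- 2 * m"] H.quotient_one_iff[OF N_normal] by simp
  then have "N n #>\<^bsub>H\<^esub> twist m b2 = N n #>\<^bsub>H\<^esub> b2" by simp
  then have "N n #>\<^bsub>H\<^esub> twist m w = N n #>\<^bsub>H\<^esub> w"
    using hom_H_eqI[OF hom q.homh q.H.is_group _ _ w] by simp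
  moreover have tw: "twist m w \<in> carrier H" using t w by (auto simp: hom_def)
  ultimately have "inv\<^bsub>H\<^esub> twist m w \<otimes>\<^bsub>H\<^esub> w \<in> N n"
    using H.quotient_eq_iff[OF N_normal tw w] by simp
  then show ?thesis
    using normal.inv_op_closed2[OF N_normal w, of "inv\<^bsub>H\<^esub> twist m w \<otimes>\<^bsub>H\<^esub> w"] w tw
    by (simp add: H.m_assoc)
qed

definition N_semi :: "nat \<Rightarrow> (word \<times> int \<times> int) set" where
  "N_semi n = N n \<times> generate G {alpha [^]\<^bsub>G\<^esub> ((2::nat) ^ (n - 1))}"

lemma generate_alpha: "generate G {alpha [^]\<^bsub>G\<^esub> (q::nat)} = {(m, 0) | m. int q dvd m}"
proof -
  have "(alpha [^]\<^bsub>G\<^esub> q) [^]\<^bsub>G\<^esub> (k::int) = (int q * k, 0)" for k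
    using G.int_pow_pow[of alpha "int q" k] by (simp add: int_pow_int G_pow)
  then show ?thesis unfolding G.generate_pow[OF G_simps(1)] by (auto simp: dvd_def)
qed

lemma N_semi_iff: "(h, (m, k)) \<in> N_semi n \<longleftrightarrow> h \<in> N n \<and> 2 ^ (n - 1) dvd m \<and> k = 0"
  by (auto simp: N_semi_def generate_alpha)

lemma N_semi_normal: "N_semi n \<lhd> P2K"
proof (rule P2K.normal_invI)
  have inv_G: "inv\<^bsub>G\<^esub> (m, 0) = (- m, 0)" for m by (rule G.inv_equality) simp_all
  show "subgroup (N_semi n) P2K"
  proof (rule P2K.subgroupI)
    show "N_semi n \<subseteq> carrier P2K" using N_carrier by (auto simp: N_semi_def carrier_P2K)
    have "\<one>\<^bsub>P2K\<^esub> \<in> N_semi n"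
      by (simp add: one_P2K N_semi_iff subgroup.one_closed[OF N_subgroup])
    then show "N_semi n \<noteq> {}" by blast
  next
    fix x assume "x \<in> N_semi n"
    then obtain h m where x: "x = (h, (m, 0))" "h \<in> N n" "2 ^ (n - 1) dvd m"
      by (cases x) (auto simp: N_semi_iff)
    then show "inv\<^bsub>P2K\<^esub> x \<in> N_semi n"
      using N_carrier by (simp add: inv_P2K inv_G N_semi_iff phi_N subgroup.m_inv_closed[OF N_subgroup] del: phi.hom_inv)
  next
    fix x y assume "x \<in> N_semi n" "y \<in> N_semi n"
    then show "x \<otimes>\<^bsub>P2K\<^esub> y \<in> N_semi n"
      by (cases x, cases y) (auto simp: mult_P2K N_semi_iff phi_N subgroup.m_closed[OF N_subgroup])
  qed
next
  fix p x assume "p \<in> carrier P2K" "x \<in> N_semi n"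
  then obtain h0 m0 k0 h m where p: "p = (h0, (m0, k0))" "h0 \<in> carrier H"
    and x: "x = (h, (m, 0))" "h \<in> N n" "2 ^ (n - 1) dvd m"
    by (cases p, cases x) (auto simp: N_semi_iff carrier_P2K)
  \<comment> \<open>m' is the exponent of \<alpha>^m after conjugation by \<beta>^k0. h' is the
    H-component of p x p^-1 with h0^-1 h0 inserted, which splits it into a conjugate of an element
    of \<open>N n\<close> and a product controlled by \<open>twist_mod_N\<close>.\<close>
  define m' where "m' = (if even k0 then m else - m)"
  define h' where "h' = h0 \<otimes>\<^bsub>H\<^esub> phi (m0, k0) h \<otimes>\<^bsub>H\<^esub> inv\<^bsub>H\<^esub> h0 \<otimes>\<^bsub>H\<^esub> (h0 \<otimes>\<^bsub>H\<^esub> inv\<^bsub>H\<^esub> twist m' h0)"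
  have m': "2 ^ (n - 1) dvd m'" using x by (simp add: m'_def)
  have hc: "h \<in> carrier H" using x N_carrier by blast
  have tc: "twist m' h0 \<in> carrier H" using twist_hom p(2) by (auto simp: hom_def)
  have "h' \<in> N n"
    unfolding h'_def
    by (intro subgroup.m_closed[OF N_subgroup] normal.inv_op_closed2[OF N_normal p(2)]
        twist_mod_N[OF m' p(2)] phi_N[OF x(2)])
  then have s: "(h', (m', 0)) \<in> N_semi n" using m' by (simp add: N_semi_iff)
  have yc: "(h', (m', 0)) \<in> carrier P2K" using \<open>h' \<in> N n\<close> N_carrier by (simp add: carrier_P2K)
  have pc: "p \<in> carrier P2K" using p by (simp add: carrier_P2K)
  \<comment> \<open>Comparing the two products avoids computing p^-1 in the semidirect
    product.\<close>
  have "(h', (m', 0)) \<otimes>\<^bsub>P2K\<^esub> p = p \<otimes>\<^bsub>P2K\<^esub> x"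
    using p x hc tc by (simp add: mult_P2K h'_def m'_def phi_eq flip_def H.word_simps)
  then have "p \<otimes>\<^bsub>P2K\<^esub> x \<otimes>\<^bsub>P2K\<^esub> inv\<^bsub>P2K\<^esub> p = (h', (m', 0)) \<otimes>\<^bsub>P2K\<^esub> p \<otimes>\<^bsub>P2K\<^esub> inv\<^bsub>P2K\<^esub> p" by simp
  also have "\<dots> = (h', (m', 0))"
    using pc yc by (simp add: P2K.m_assoc)
  finally show "p \<otimes>\<^bsub>P2K\<^esub> x \<otimes>\<^bsub>P2K\<^esub> inv\<^bsub>P2K\<^esub> p \<in> N_semi n" using s by simp
qed

lemma emb_N: "w \<in> N n \<Longrightarrow> emb w \<in> K.closure_term n"
proof -
  have s: "subgroup {w \<in> carrier H. emb w \<in> K.closure_term n} H"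
    by (rule H.subgroup_vimage[OF emb.group_hom_axioms K.closure_term_subgroup])
  have "{w \<in> carrier H. emb w \<in> K.closure_term n} \<lhd> H"
    by (rule H.normal_invI[OF s]) (use normal.inv_op_closed2[OF K.closure_term_normal] in simp)
  moreover have "N_gens n \<subseteq> {w \<in> carrier H. emb w \<in> K.closure_term n}"
  proof
    fix y assume y: "y \<in> N_gens n"
    have "emb (a2 [^]\<^bsub>H\<^esub> (2::nat) ^ (n - 1)) \<in> K.closure_term n"
      using K.a_pow_closure_term by (simp add: emb.hom_nat_pow)
    moreover have "emb (x [^]\<^bsub>H\<^esub> (2::nat) ^ (n - i)) \<in> K.closure_term n"
      if "2 \<le> i" "i \<le> n" "x \<in> Gamma H i" for x i
      using K.fibre_pow_closure_term[OF that(1,2), of "emb x"] that(3) Gamma_H_carrier[OF that(3)]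
      by (simp add: emb.hom_nat_pow fibre_eq)
    ultimately show "y \<in> {w \<in> carrier H. emb w \<in> K.closure_term n}"
      using y subsetD[OF N_gens_carrier y] by (auto simp: N_gens_def)
  qed
  ultimately have "N n \<subseteq> {w \<in> carrier H. emb w \<in> K.closure_term n}"
    unfolding N_eq using H.normal_closure_least by blast
  then show "w \<in> N n \<Longrightarrow> emb w \<in> K.closure_term n" by blast
qed

lemma closure_term_eq: "K.closure_term n = N_semi n"
proof
  show "K.closure_term n \<subseteq> N_semi n"
  proof (rule K.closure_term_least[OF N_semi_normal])
    show "emb a2 [^]\<^bsub>P2K\<^esub> ((2::nat) ^ (n - 1)) \<in> N_semi n"
      using a2_pow_N[of n "int (2 ^ (n - 1))"] unfolding int_pow_int
      by (simp add: emb.hom_nat_pow[symmetric]) (simp add: emb_def N_semi_iff)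
    show "lift_G alpha [^]\<^bsub>P2K\<^esub> ((2::nat) ^ (n - 1)) \<in> N_semi n"
      using subgroup.one_closed[OF N_subgroup] G_pow(1)[of "int (2 ^ (n - 1))"] unfolding int_pow_int
      by (simp add: lift_G.hom_nat_pow[symmetric]) (simp add: lift_G_def N_semi_iff)
    fix x i assume i: "2 \<le> i" "i \<le> n" and "x \<in> K.fibre i"
    then obtain y where y: "x = emb y" "y \<in> Gamma H i" by (auto simp: fibre_eq)
    then show "x [^]\<^bsub>P2K\<^esub> ((2::nat) ^ (n - i)) \<in> N_semi n"
      using Gamma_pow_N[OF i y(2)] Gamma_H_carrier[OF y(2)]
      by (simp add: emb.hom_nat_pow[symmetric]) (simp add: emb_def N_semi_iff)
  qed
  have "generate G {alpha [^]\<^bsub>G\<^esub> ((2::nat) ^ (n - 1))} \<subseteq> {g \<in> carrier G. lift_G g \<in> K.closure_term n}"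
    by (rule G.generate_subgroup_incl[OF _ G.subgroup_vimage[OF lift_G.group_hom_axioms K.closure_term_subgroup]])
       (use K.s_pow_closure_term in \<open>simp add: lift_G.hom_nat_pow\<close>)
  moreover have "(h, g) \<in> K.closure_term n" if "h \<in> N n" "lift_G g \<in> K.closure_term n" for h g
    using subgroup.m_closed[OF K.closure_term_subgroup emb_N[OF that(1)] that(2)]
    by (simp only: emb_lift_G[OF N_carrier[OF that(1)]])
  ultimately show "N_semi n \<subseteq> K.closure_term n"
    unfolding N_semi_def by blast
qed

lemma Gamma_P2K:
  assumes "2 \<le> n" shows "Gamma P2K n = N n \<times> generate G {alpha [^]\<^bsub>G\<^esub> ((2::nat) ^ (n - 1))}"
  using K.lower_eq_closure_term[OF assms] closure_term_eq
  by (simp add: K.lower_def Gamma_eq_lcs N_semi_def)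

subsection \<open>Sanov's embedding and residual nilpotence\<close>

type_synonym mat2 = "int \<times> int \<times> int \<times> int"

fun mat_mult :: "mat2 \<Rightarrow> mat2 \<Rightarrow> mat2" where
  "mat_mult (a, b, c, d) (a', b', c', d') =
     (a * a' + b * c', a * b' + b * d', c * a' + d * c', c * b' + d * d')"

definition SL2 :: "mat2 monoid" where
  "SL2 = \<lparr>carrier = {(a, b, c, d). a * d - b * c = 1}, monoid.mult = mat_mult, one = (1, 0, 0, 1)\<rparr>"

lemma SL2_simps [simp]:
  "(a, b, c, d) \<in> carrier SL2 \<longleftrightarrow> a * d - b * c = 1"
  "x \<otimes>\<^bsub>SL2\<^esub> y = mat_mult x y" "\<one>\<^bsub>SL2\<^esub> = (1, 0, 0, 1)"
  by (simp_all add: SL2_def)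

lemma mat_mult_det:
  fixes a b c d a' b' c' d' :: int
  shows "(a * a' + b * c') * (c * b' + d * d') - (a * b' + b * d') * (c * a' + d * c') =
    (a * d - b * c) * (a' * d' - b' * c')"
  by (simp add: algebra_simps)

lemma group_SL2: "group SL2"
proof (rule groupI)
  fix x y assume "x \<in> carrier SL2" "y \<in> carrier SL2"
  then show "x \<otimes>\<^bsub>SL2\<^esub> y \<in> carrier SL2"
    by (cases x, cases y) (simp add: mat_mult_det)
next
  fix x assume x: "x \<in> carrier SL2"
  obtain a b c d where abcd: "x = (a, b, c, d)" by (cases x)
  have "(d, - b, - c, a) \<in> carrier SL2" "(d, - b, - c, a) \<otimes>\<^bsub>SL2\<^esub> x = \<one>\<^bsub>SL2\<^esub>"
    using x by (simp_all add: abcd algebra_simps)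
  then show "\<exists>y\<in>carrier SL2. y \<otimes>\<^bsub>SL2\<^esub> x = \<one>\<^bsub>SL2\<^esub>" by blast
next
  fix x y z show "x \<otimes>\<^bsub>SL2\<^esub> y \<otimes>\<^bsub>SL2\<^esub> z = x \<otimes>\<^bsub>SL2\<^esub> (y \<otimes>\<^bsub>SL2\<^esub> z)"
    by (cases x, cases y, cases z) (simp add: algebra_simps)
next
  fix x show "\<one>\<^bsub>SL2\<^esub> \<otimes>\<^bsub>SL2\<^esub> x = x" by (cases x) simp
qed simp

interpretation SL2: group SL2 by (rule group_SL2)

lemma inv_SL2: "(a, b, c, d) \<in> carrier SL2 \<Longrightarrow> inv\<^bsub>SL2\<^esub> (a, b, c, d) = (d, - b, - c, a)"
  by (rule SL2.inv_equality) (simp_all add: algebra_simps)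

section \<open>Principal congruence subgroups of level 2^n\<close>

definition level :: "nat \<Rightarrow> mat2 set" where
  "level n = {(a, b, c, d) \<in> carrier SL2.
     2 ^ n dvd a - 1 \<and> 2 ^ n dvd b \<and> 2 ^ n dvd c \<and> 2 ^ n dvd d - 1}"

lemma level_iff:
  "(a, b, c, d) \<in> level n \<longleftrightarrow> a * d - b * c = 1 \<and>
    (\<exists>p q r s. a = 1 + 2 ^ n * p \<and> b = 2 ^ n * q \<and> c = 2 ^ n * r \<and> d = 1 + 2 ^ n * s)"
proof -
  have "2 ^ n dvd x - 1 \<longleftrightarrow> (\<exists>p. x = 1 + 2 ^ n * p)" for x :: int
    by (metis add_diff_cancel_left' add.commute diff_add_cancel dvd_def dvd_triv_left)
  then show ?thesis unfolding level_def by (auto simp: dvd_def)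
qed

lemma level_mult:
  assumes "x \<in> level n" "y \<in> level n" shows "mat_mult x y \<in> level n"
proof -
  obtain a b c d a' b' c' d' where xy: "x = (a, b, c, d)" "y = (a', b', c', d')"
    by (cases x, cases y)
  have "2 ^ n dvd (a - 1) * a' + (a' - 1) + b * c'" "2 ^ n dvd c * b' + (d - 1) * d' + (d' - 1)"
    "2 ^ n dvd a * b' + b * d'" "2 ^ n dvd c * a' + d * c'"
    using assms unfolding xy level_def by (auto intro!: dvd_add dvd_mult dvd_mult2)
  moreover have "(a - 1) * a' + (a' - 1) + b * c' = a * a' + b * c' - 1"
    "c * b' + (d - 1) * d' + (d' - 1) = c * b' + d * d' - 1" by (simp_all add: algebra_simps)
  ultimately show ?thesis
    using assms unfolding xy level_def by (auto simp: mat_mult_det)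
qed

lemma level_inv:
  assumes "x \<in> level n" shows "inv\<^bsub>SL2\<^esub> x \<in> level n"
  using assms by (cases x) (auto simp: level_def inv_SL2 mult.commute)

lemma level_conj:
  assumes x: "x \<in> level n" and g: "g \<in> carrier SL2"
  shows "g \<otimes>\<^bsub>SL2\<^esub> x \<otimes>\<^bsub>SL2\<^esub> inv\<^bsub>SL2\<^esub> g \<in> level n"
proof -
  obtain a b c d where xa: "x = (a, b, c, d)" by (cases x)
  then obtain p q r s where x': "a = 1 + 2 ^ n * p" "b = 2 ^ n * q" "c = 2 ^ n * r" "d = 1 + 2 ^ n * s"
    using x by (auto simp: level_iff)
  obtain e f h k where ge: "g = (e, f, h, k)" by (cases g)
  have det: "e * k - f * h = 1" using g ge by simp
  have xc: "x \<in> carrier SL2" using x by (auto simp: level_def)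
  have "g \<otimes>\<^bsub>SL2\<^esub> x \<otimes>\<^bsub>SL2\<^esub> inv\<^bsub>SL2\<^esub> g \<in> carrier SL2" using g xc by (simp del: SL2_simps)
  \<comment> \<open>With x = 1 + 2^n X the conjugate is 1 + 2^n g X g^-1; the bracketed expressions
    are the entries of g X g^-1.\<close>
  moreover have "g \<otimes>\<^bsub>SL2\<^esub> x \<otimes>\<^bsub>SL2\<^esub> inv\<^bsub>SL2\<^esub> g =
     (1 + 2 ^ n * ((e * p + f * r) * k - (e * q + f * s) * h), 2 ^ n * ((e * q + f * s) * e - (e * p + f * r) * f),
      2 ^ n * ((h * p + k * r) * k - (h * q + k * s) * h), 1 + 2 ^ n * ((h * q + k * s) * e - (h * p + k * r) * f))"
    using det g unfolding xa ge x' by (simp add: inv_SL2) (simp add: algebra_simps)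
  ultimately show ?thesis by (auto simp: level_iff)
qed

lemma level_normal: "level n \<lhd> SL2"
proof (rule SL2.normal_invI)
  show "subgroup (level n) SL2"
  proof (rule SL2.subgroupI)
    have "(1, 0, 0, 1) \<in> level n" by (simp add: level_def)
    then show "level n \<noteq> {}" by blast
  qed (use level_mult level_inv in \<open>auto simp: level_def\<close>)
qed (rule level_conj)

text \<open>Write x = 1 + 2^i X and y = 1 + 2 Y. Then x y - y x = 2^(i+1) (X Y - Y X), so [x,y] = (y
  x)^-1 x y equals 1 + 2^(i+1) (y x)^-1 (X Y - Y X). The entries of X Y - Y X are \<open>A\<close>,
  \<open>B\<close>, \<open>C\<close>, \<open>D\<close>.\<close>

lemma level_commutator:
  assumes x: "x \<in> level i" and y: "y \<in> level 1"
  shows "commutator SL2 x y \<in> level (Suc i)"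
proof -
  obtain a b c d a' b' c' d' where xy: "x = (a, b, c, d)" "y = (a', b', c', d')"
    by (cases x, cases y)
  obtain p q r s where x': "a = 1 + 2 ^ i * p" "b = 2 ^ i * q" "c = 2 ^ i * r" "d = 1 + 2 ^ i * s"
    using x unfolding xy level_iff by blast
  obtain p' q' r' s' where y': "a' = 1 + 2 * p'" "b' = 2 * q'" "c' = 2 * r'" "d' = 1 + 2 * s'"
    using y unfolding xy level_iff by auto
  have car: "x \<in> carrier SL2" "y \<in> carrier SL2" using x y by (auto simp: level_def)
  have det: "a * d - b * c = 1" "a' * d' - b' * c' = 1" using car unfolding xy by simp_all
  have "commutator SL2 x y = inv\<^bsub>SL2\<^esub> (y \<otimes>\<^bsub>SL2\<^esub> x) \<otimes>\<^bsub>SL2\<^esub> (x \<otimes>\<^bsub>SL2\<^esub> y)"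
    using car by (simp add: commutator_def SL2.word_simps del: SL2_simps)
  moreover obtain e f g h where yx: "y \<otimes>\<^bsub>SL2\<^esub> x = (e, f, g, h)" by (cases "y \<otimes>\<^bsub>SL2\<^esub> x")
  moreover have dyx: "e * h - f * g = 1" using yx car SL2.m_closed[of y x] by (metis SL2_simps(1))
  define A B C D where abcd: "A = q * r' - q' * r" "B = p * q' + q * s' - p' * q - q' * s"
    "C = r * p' + s * r' - r' * p - s' * r" "D = r * q' - r' * q"
  have "x \<otimes>\<^bsub>SL2\<^esub> y = (e + 2 ^ Suc i * A, f + 2 ^ Suc i * B, g + 2 ^ Suc i * C, h + 2 ^ Suc i * D)"
    using yx unfolding xy x' y' abcd by (simp add: algebra_simps)
  ultimately have "commutator SL2 x y =
     (1 + 2 ^ Suc i * (h * A - f * C), 2 ^ Suc i * (h * B - f * D),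
      2 ^ Suc i * (e * C - g * A), 1 + 2 ^ Suc i * (e * D - g * B))"
    using dyx by (simp add: inv_SL2) (simp add: algebra_simps)
  moreover have "commutator SL2 x y \<in> carrier SL2" using car by simp
  ultimately show ?thesis by (auto simp: level_iff)
qed

text \<open>(1 + 2^i X)^2 = 1 + 2^(i+1) (X + 2^(i-1) X^2), where i >= 1 keeps the bracket
  integral.\<close>

lemma level_square:
  assumes i: "1 \<le> i" and x: "x \<in> level i"
  shows "x \<otimes>\<^bsub>SL2\<^esub> x \<in> level (Suc i)"
proof -
  obtain a b c d where xa: "x = (a, b, c, d)" by (cases x)
  then obtain p q r s where x': "a = 1 + 2 ^ i * p" "b = 2 ^ i * q" "c = 2 ^ i * r" "d = 1 + 2 ^ i * s"
    using x by (auto simp: level_iff)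
  obtain j where j: "i = Suc j" using i by (cases i) auto
  have "x \<in> carrier SL2" using x by (auto simp: level_def)
  then have "x \<otimes>\<^bsub>SL2\<^esub> x \<in> carrier SL2" by (rule SL2.m_closed) fact
  moreover have "x \<otimes>\<^bsub>SL2\<^esub> x =
     (1 + 2 ^ Suc i * (p + 2 ^ j * (p * p + q * r)), 2 ^ Suc i * (q + 2 ^ j * (p * q + q * s)),
      2 ^ Suc i * (r + 2 ^ j * (r * p + s * r)), 1 + 2 ^ Suc i * (s + 2 ^ j * (r * q + s * s)))"
    unfolding xa x' j by (simp add: algebra_simps)
  ultimately show ?thesis by (auto simp: level_iff)
qed

lemma level_pow:
  assumes "1 \<le> i" "x \<in> level i" shows "x [^]\<^bsub>SL2\<^esub> ((2::nat) ^ k) \<in> level (i + k)"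
proof (induction k)
  case 0
  then show ?case using assms by (auto simp: level_def simp del: SL2_simps(2,3))
next
  case (Suc k)
  have "x \<in> carrier SL2" using assms by (auto simp: level_def)
  then show ?case
    using level_square[OF _ Suc] assms(1) SL2.pow_two_power_Suc[of x k] by (simp del: SL2_simps)
qed

text \<open>The entry 2 serves two purposes: it gives table tennis enough room, and it puts both
  generators into \<open>level 1\<close>.\<close>

definition sanov :: "word \<Rightarrow> mat2" where
  "sanov = word_val SL2 (\<lambda>x. case x of A2 \<Rightarrow> (1, 2, 0, 1) | B2 \<Rightarrow> (1, 0, 2, 1))"

interpretation sanov: group_hom H SL2 sanov
  unfolding group_hom_def group_hom_axioms_def sanov_def
  by (intro conjI group_H group_SL2 SL2.word_val_hom) (simp split: gen.split)

lemma sanov_gen: "sanov a2 = (1, 2, 0, 1)" "sanov b2 = (1, 0, 2, 1)"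
  unfolding sanov_def by (subst SL2.word_val_gen; simp split: gen.split)+

lemma sanov_level_1: "w \<in> carrier H \<Longrightarrow> sanov w \<in> level 1"
proof -
  note s = normal_imp_subgroup[OF level_normal[of 1]]
  have gens: "sanov a2 \<in> level 1" "sanov b2 \<in> level 1" by (simp_all add: sanov_gen level_def)
  assume "w \<in> carrier H"
  then show ?thesis
    by (induction rule: H_induct)
       (use gens subgroup.m_closed[OF s] subgroup.m_inv_closed[OF s] subgroup.one_closed[OF s]
        in \<open>simp_all del: SL2_simps\<close>)
qed

lemma sanov_Gamma:
  assumes "1 \<le> i" "w \<in> Gamma H i" shows "sanov w \<in> level i"
proof -
  have "lcs H (carrier H) i \<subseteq> {w \<in> carrier H. sanov w \<in> level i}"
    using assms(1)
  proof (induction i rule: nat_induct_at_least)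
    case base
    then show ?case using sanov_level_1 by auto
  next
    case (Suc i)
    show ?case
    proof (rule H.lcs_Suc_least[OF Suc.hyps H.subgroup_vimage[OF sanov.group_hom_axioms]])
      fix x y assume "x \<in> lcs H (carrier H) i" "y \<in> carrier H"
      then show "commutator H x y \<in> {w \<in> carrier H. sanov w \<in> level (Suc i)}"
        using Suc.IH level_commutator[of "sanov x" i "sanov y"] sanov_level_1[of y]
        by (auto simp: sanov.hom_commutator)
    qed (rule normal_imp_subgroup[OF level_normal])
  qed
  then show ?thesis using assms(2) by (auto simp: Gamma_eq_lcs)
qed

section \<open>Table tennis on integer vectors\<close>

fun letter_act :: "letter \<Rightarrow> int \<times> int \<Rightarrow> int \<times> int" where
  "letter_act (A2, e) (x, y) = (if e then x - 2 * y else x + 2 * y, y)"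
| "letter_act (B2, e) (x, y) = (x, if e then y - 2 * x else y + 2 * x)"

fun mat_apply :: "mat2 \<Rightarrow> int \<times> int \<Rightarrow> int \<times> int" where
  "mat_apply (a, b, c, d) (x, y) = (a * x + b * y, c * x + d * y)"

lemma mat_apply_mult: "mat_apply (mat_mult m m') v = mat_apply m (mat_apply m' v)"
  by (cases m, cases m', cases v) (simp add: algebra_simps)

lemma sanov_apply: "mat_apply (sanov w) v = foldr letter_act w v"
proof (induction w)
  case Nil
  then show ?case by (cases v) (simp add: sanov_def word_val_def)
next
  case (Cons l w)
  obtain x e where l: "l = (x, e)" by (cases l)
  have "mat_apply (letter_val SL2 (\<lambda>x. case x of A2 \<Rightarrow> (1, 2, 0, 1) | B2 \<Rightarrow> (1, 0, 2, 1)) l) u = letter_act l u" for u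
    by (cases u; cases x) (simp_all add: l letter_val_def inv_SL2)
  then show ?case using Cons by (simp add: sanov_def word_val_def mat_apply_mult)
qed

text \<open>The table-tennis ping_pong of a letter; it excludes the two starting vectors.\<close>
fun ping_pong :: "letter \<Rightarrow> int \<times> int \<Rightarrow> bool" where
  "ping_pong (A2, e) (x, y) \<longleftrightarrow> \<bar>y\<bar> < \<bar>x\<bar> \<and> 2 \<le> \<bar>x\<bar> \<and>
     (if e then 0 \<le> x \<and> y \<le> 0 \<or> x \<le> 0 \<and> 0 \<le> y else 0 \<le> x \<and> 0 \<le> y \<or> x \<le> 0 \<and> y \<le> 0)"
| "ping_pong (B2, e) (x, y) \<longleftrightarrow> \<bar>x\<bar> < \<bar>y\<bar> \<and> 2 \<le> \<bar>y\<bar> \<and>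
     (if e then 0 \<le> x \<and> y \<le> 0 \<or> x \<le> 0 \<and> 0 \<le> y else 0 \<le> x \<and> 0 \<le> y \<or> x \<le> 0 \<and> y \<le> 0)"

text \<open>Let k change the first coordinate x. If the previous letter used the other generator,
  then |x| < |y|, so x + 2y and x - 2y exceed |y| in absolute value and the term with y determines
  the sign. If the previous letter was k itself, the signs are such that |x| does not decrease. The
  sign condition lets single letters play in place of powers of a generator.\<close>

lemma ping_pong_act:
  assumes "ping_pong l v" "l \<noteq> inv_letter k" shows "ping_pong k (letter_act k v)"
proof -
  obtain z e z' e' x y where "l = (z, e)" "k = (z', e')" "v = (x, y)" by (cases l, cases k, cases v)
  then show ?thesis using assms
    by (cases z; cases z'; cases e; cases e') (auto simp: inv_letter_def)
qed

text \<open>The start vector is determined by the last letter of the word: (0,1) for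
  \<open>A2\<close> and (1,0) for \<open>B2\<close>, each moved into the region of that letter in
  one step.\<close>

lemma ping_pong_word:
  assumes "reduced (l # w)"
  shows "\<exists>v\<in>{(1, 0), (0, 1)}. ping_pong l (foldr letter_act (l # w) v)"
  using assms
proof (induction w arbitrary: l)
  case Nil
  obtain x e where "l = (x, e)" by (cases l)
  then show ?case by (cases x; cases e) auto
next
  case (Cons k w)
  then have r: "reduced (k # w)" and k: "k \<noteq> inv_letter l" by simp_all
  obtain v where v: "v \<in> {(1, 0), (0, 1)}" "ping_pong k (foldr letter_act (k # w) v)"
    using Cons.IH[OF r] by blast
  have "ping_pong l (letter_act l (foldr letter_act (k # w) v))"
    by (rule ping_pong_act[OF v(2) k])
  then show ?case using v(1) by auto
qed

text \<open>The identity matrix would leave the start vector where it is, but its coordinates are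
  too small for any region.\<close>

lemma sanov_inj:
  assumes "reduced w" "sanov w = (1, 0, 0, 1)" shows "w = []"
proof (cases w)
  case (Cons l w')
  then obtain v where v: "v \<in> {(1, 0), (0, 1)}" "ping_pong l (foldr letter_act w v)"
    using ping_pong_word assms(1) by blast
  then have "ping_pong l v" using sanov_apply[of w v] assms(2) by (cases v) simp
  then show ?thesis using v(1) by (cases l rule: prod.exhaust; cases "fst l") auto
qed simp

lemma int_eq_zero_if_powers_dvd:
  fixes z :: int
  assumes "\<And>n. n \<ge> 2 \<Longrightarrow> 2 ^ (n - 1) dvd z" shows "z = 0"
proof (rule ccontr)
  assume "z \<noteq> 0"
  \<comment> \<open>The margin 2 ensures n >= 2 and |z| < n - 1 < 2^(n-1).\<close>
  define n where "n = nat \<bar>z\<bar> + 2"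
  have "2 ^ (n - 1) dvd z" using assms[of n] by (simp add: n_def)
  then have "\<bar>2 ^ (n - 1)\<bar> \<le> \<bar>z\<bar>" by (rule dvd_imp_le_int[OF \<open>z \<noteq> 0\<close>])
  moreover have "int (n - 1) < 2 ^ (n - 1)" by (rule of_nat_less_two_power)
  moreover have "\<bar>z\<bar> < int (n - 1)" by (simp add: n_def)
  ultimately show False by simp
qed

lemma level_Inter:
  assumes "\<And>n. n \<ge> 2 \<Longrightarrow> x \<in> level n" shows "x = (1, 0, 0, 1)"
proof -
  obtain a b c d where x: "x = (a, b, c, d)" by (cases x)
  have dvd: "2 ^ n dvd a - 1 \<and> 2 ^ n dvd b \<and> 2 ^ n dvd c \<and> 2 ^ n dvd d - 1" if "n \<ge> 2" for n
    using assms[OF that] by (simp add: x level_def)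
  have zero: "z = 0" if "\<And>n. n \<ge> 2 \<Longrightarrow> 2 ^ n dvd z" for z :: int
    by (rule int_eq_zero_if_powers_dvd, rule power_le_dvd, rule that, assumption, rule diff_le_self)
  have "a - 1 = 0" "b = 0" "c = 0" "d - 1 = 0"
    by (rule zero; use dvd in simp)+
  then show ?thesis by (simp add: x)
qed

text \<open>\<Gamma>_i is mapped into \<open>level i\<close>, and each of the n - i squarings raises
  the index by one, so every normal generator of \<open>N n\<close> arrives in
  \<open>level n\<close>.\<close>

lemma sanov_N:
  assumes n: "2 \<le> n" and w: "w \<in> N n" shows "sanov w \<in> level n"
proof -
  note sn = normal_imp_subgroup[OF level_normal[of n]]
  have s: "subgroup {w \<in> carrier H. sanov w \<in> level n} H"
    by (rule H.subgroup_vimage[OF sanov.group_hom_axioms sn])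
  have x: "sanov (x [^]\<^bsub>H\<^esub> (2::nat) ^ (n - i)) \<in> level n" "x \<in> carrier H"
    if "1 \<le> i" "i \<le> n" "x \<in> Gamma H i" for x i
  proof -
    show "x \<in> carrier H" using that(3) H.lcs_mem_carrier[OF H.normal_self] by (simp add: Gamma_eq_lcs)
    then show "sanov (x [^]\<^bsub>H\<^esub> (2::nat) ^ (n - i)) \<in> level n"
      using level_pow[OF that(1) sanov_Gamma[OF that(1,3)], of "n - i"] that(2)
      by (simp add: sanov.hom_nat_pow)
  qed
  have "N n \<subseteq> {w \<in> carrier H. sanov w \<in> level n}"
    unfolding N_def normal_closure_def
  proof (rule H.generate_subgroup_incl[OF _ s], clarify, intro conjI)
    fix g y assume g: "g \<in> carrier H"
      and "y \<in> {a2 [^]\<^bsub>H\<^esub> (2::nat) ^ (n - 1)} \<union>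
        {x [^]\<^bsub>H\<^esub> (2::nat) ^ (n - i) |x i. 2 \<le> i \<and> i \<le> n \<and> x \<in> Gamma H i}"
    \<comment> \<open>Reading a2 as an element of \<Gamma>_1 turns its power into the case i = 1 of
      the second family.\<close>
    moreover have "a2 \<in> Gamma H 1" by simp
    ultimately obtain x i where xi: "1 \<le> i" "i \<le> n" "x \<in> Gamma H i"
      "y = x [^]\<^bsub>H\<^esub> (2::nat) ^ (n - i)"
      using n by (elim UnE) (force, clarify, metis one_le_numeral order_trans)
    then have y: "y \<in> carrier H" "sanov y \<in> level n"
      using x[OF xi(1-3)] by simp_all
    show "g \<otimes>\<^bsub>H\<^esub> y \<otimes>\<^bsub>H\<^esub> inv\<^bsub>H\<^esub> g \<in> carrier H" using g y by simp
    show "sanov (g \<otimes>\<^bsub>H\<^esub> y \<otimes>\<^bsub>H\<^esub> inv\<^bsub>H\<^esub> g) \<in> level n"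
      using normal.inv_op_closed2[OF level_normal sanov.hom_closed[OF g] y(2)] g y
      by (simp del: SL2_simps)
  qed
  then show ?thesis using w by blast
qed

lemma N_Inter:
  assumes "w \<in> carrier H" "\<And>n. n \<ge> 2 \<Longrightarrow> w \<in> N n" shows "w = []"
  using sanov_inj[of w] level_Inter[of "sanov w"] sanov_N assms by (simp add: carrier_H)

lemma one_mem_Gamma_P2K: "\<one>\<^bsub>P2K\<^esub> \<in> Gamma P2K n"
  using subgroup.one_closed[OF P2K.lcs_subgroup[OF P2K.normal_self]] by (simp add: Gamma_eq_lcs)

theorem theorem5p3:
  shows "(\<forall>n::nat. n \<ge> 2 \<longrightarrow>
            Gamma P2K n = N n \<times> generate G {alpha [^]\<^bsub>G\<^esub> ((2::nat) ^ (n - 1))})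
         \<and> residually_nilpotent P2K"
proof (intro conjI allI impI)
  show "Gamma P2K n = N n \<times> generate G {alpha [^]\<^bsub>G\<^esub> ((2::nat) ^ (n - 1))}" if "n \<ge> 2" for n
    using Gamma_P2K[OF that] .
  have "x = \<one>\<^bsub>P2K\<^esub>" if "x \<in> (\<Inter>i\<in>{1..}. Gamma P2K i)" for x
  proof -
    obtain h m k where x: "x = (h, (m, k))" by (cases x)
    have *: "h \<in> N n \<and> 2 ^ (n - 1) dvd m \<and> k = 0" if "n \<ge> 2" for n
    proof -
      have "x \<in> Gamma P2K n" using \<open>x \<in> _\<close> that by auto
      then show ?thesis using Gamma_P2K[OF that] N_semi_iff[of h m k n] by (simp add: x N_semi_def)
    qed
    have "h = []" using N_Inter[of h] * N_carrier by blast
    moreover have "m = 0" by (rule int_eq_zero_if_powers_dvd) (use * in blast)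
    ultimately show ?thesis using *[of 2] by (simp add: x one_P2K one_H)
  qed
  then show "residually_nilpotent P2K"
    unfolding residually_nilpotent_def using one_mem_Gamma_P2K by blast
qed

end
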